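(* There exist absolute constants $C,c>0$ such that the following holds. Let $G$ be a regular graph on $V=[n]$, let $\epsilon>0$, and let $X_1,\dots,X_n$ be $r$-local random variables over $[k]$. Suppose that for every $S\subseteq V$ with $|S|\le r$ and every local assignment $x_S\in[k]^S$ (of positive probability), the matrix $\big(\mathrm{Cov}(X_{ia},X_{jb}\mid X_S=x_S)\big)_{(i,a),(j,b)\in V\times[k]}$ is positive semidefinite. Let $X'_1,\dots,X'_n$ be the (jointly distributed) random variables produced by Propagation Sampling on input $X_1,\dots,X_n$. If $r\ge C\,(k/\epsilon^4)\cdot\mathrm{rank}_{\ge c(\epsilon/k)^2}(G)$, then $$\mathbb E_{ij\sim G}\big\|\{X_iX_j\}-\{X'_iX'_j\}\big\|_1\le\epsilon.$$
   Context: $r$-local random variables $X_1,\dots,X_n$ over $[k]$: a family of distributions $\mu_T$ on $[k]^T$ for all $T\subseteq V$ with $|T|\le r+2$ that are consistent (agree on marginals of intersections); for $|T|\le r+2$, $X_T$ denotes a sample of $\mu_T$, and conditional quantities given $X_S=x_S$ are computed in $\mu_{S\cup\{i,j\}}$. $X_{ia}$ is the indicator of $X_i=a$. $\{X_iX_j\}$ denotes the joint distribution of $(X_i,X_j)$ (i.e. $\mu_{\{i,j\}}$), and $\{X'_iX'_j\}$ the joint distribution of $(X'_i,X'_j)$. For distributions $P,Q$ on a finite set, $\|P-Q\|_1=\sum_x|P(x)-Q(x)|$. Propagation Sampling: choose $m\in\{1,\dots,r\}$ uniformly; choose $S\in V^m$ uniformly (repetitions allowed, treated as a set); sample $x_S\sim\mu_S$;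 for each $i\in V\setminus S$ independently sample $x_i$ from $\mu_{S\cup\{i\}}$ conditioned on $X_S=x_S$; output $X'=x$. A regular graph is identified with its normalized adjacency matrix (symmetric, nonnegative, row sums $1$); $\mathrm{rank}_{\ge\tau}(G)$ is the number of its eigenvalues larger than $\tau$; $\mathbb E_{ij\sim G}$ means $i$ uniform in $V$ and $j$ chosen with probability $G_{ij}$. *)

theory Defs
  imports
    "HOL-Probability.Probability"
    "HOL-Computational_Algebra.Fundamental_Theorem_Algebra"
    "Jordan_Normal_Form.Char_Poly"
begin

text \<open>
  The vertex set \<open>[n]\<close> is rendered as \<open>{..<n}\<close> and the alphabet \<open>[k]\<close> as \<open>{..<k}\<close>.
  Elements of \<open>[k]\<^sup>T\<close> are extensional functions, i.e. members of \<open>T \<rightarrow>\<^sub>E {..<k}\<close>.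
\<close>

text \<open>A regular graph is identified with its normalized adjacency matrix.\<close>

definition regular_graph :: "nat \<Rightarrow> real mat \<Rightarrow> bool" where
  "regular_graph n G \<longleftrightarrow>
     G \<in> carrier_mat n n \<and>
     (\<forall>i<n. \<forall>j<n. G $$ (i, j) = G $$ (j, i)) \<and>
     (\<forall>i<n. \<forall>j<n. 0 \<le> G $$ (i, j)) \<and>
     (\<forall>i<n. (\<Sum>j<n. G $$ (i, j)) = 1)"

text \<open>Eigenvalues larger than \<open>\<tau>\<close>, counted with multiplicity.\<close>

definition threshold_rank :: "real \<Rightarrow> real mat \<Rightarrow> nat" where
  "threshold_rank \<tau> G = size {# x \<in># proots (char_poly G). x > \<tau> #}"

definition edge_expectation :: "nat \<Rightarrow> real mat \<Rightarrow> (nat \<Rightarrow> nat \<Rightarrow> real) \<Rightarrow> real" where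
  "edge_expectation n G f = (\<Sum>i<n. 1 / real n * (\<Sum>j<n. G $$ (i, j) * f i j))"

definition local_rvs :: "nat \<Rightarrow> nat \<Rightarrow> nat \<Rightarrow> (nat set \<Rightarrow> (nat \<Rightarrow> nat) pmf) \<Rightarrow> bool" where
  "local_rvs n k r \<mu> \<longleftrightarrow>
     (\<forall>T \<subseteq> {..<n}. card T \<le> r + 2 \<longrightarrow> set_pmf (\<mu> T) \<subseteq> T \<rightarrow>\<^sub>E {..<k}) \<and>
     (\<forall>T \<subseteq> {..<n}. \<forall>T' \<subseteq> {..<n}. card T \<le> r + 2 \<longrightarrow> card T' \<le> r + 2 \<longrightarrow>
        map_pmf (\<lambda>x. restrict x (T \<inter> T')) (\<mu> T) = map_pmf (\<lambda>x. restrict x (T \<inter> T')) (\<mu> T'))"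

text \<open>
  The distribution of \<open>X\<^bsub>S \<union> T\<^esub>\<close> conditioned on \<open>X\<^sub>S = y\<close>, computed in \<open>\<mu> (S \<union> T)\<close>. It is meaningful
  only if \<open>y\<close> has positive probability, i.e. \<open>y \<in> set_pmf (\<mu> S)\<close>.
\<close>

definition cond_local ::
  "(nat set \<Rightarrow> (nat \<Rightarrow> nat) pmf) \<Rightarrow> nat set \<Rightarrow> (nat \<Rightarrow> nat) \<Rightarrow> nat set \<Rightarrow> (nat \<Rightarrow> nat) pmf" where
  "cond_local \<mu> S y T = cond_pmf (\<mu> (S \<union> T)) {x. restrict x S = y}"

definition covariance :: "'a pmf \<Rightarrow> ('a \<Rightarrow> real) \<Rightarrow> ('a \<Rightarrow> real) \<Rightarrow> real" where
  "covariance p f g =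
     measure_pmf.expectation p
       (\<lambda>x. (f x - measure_pmf.expectation p f) * (g x - measure_pmf.expectation p g))"

definition cond_cov_matrix ::
  "(nat set \<Rightarrow> (nat \<Rightarrow> nat) pmf) \<Rightarrow> nat set \<Rightarrow> (nat \<Rightarrow> nat) \<Rightarrow> nat \<times> nat \<Rightarrow> nat \<times> nat \<Rightarrow> real" where
  "cond_cov_matrix \<mu> S y = (\<lambda>(i, a) (j, b).
     covariance (cond_local \<mu> S y {i, j}) (\<lambda>x. of_bool (x i = a)) (\<lambda>x. of_bool (x j = b)))"

definition pos_semidef_on :: "'i set \<Rightarrow> ('i \<Rightarrow> 'i \<Rightarrow> real) \<Rightarrow> bool" where
  "pos_semidef_on I M \<longleftrightarrow>
     (\<forall>p\<in>I. \<forall>q\<in>I. M p q = M q p) \<and>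
     (\<forall>z. 0 \<le> (\<Sum>p\<in>I. \<Sum>q\<in>I. z p * M p q * z q))"

text \<open>
  A uniform element of \<open>V\<^sup>m\<close> is a uniform list of length \<open>m\<close>; \<open>S\<close> is its set of entries. In
  \<open>Pi_pmf\<close> the default value \<open>undefined\<close> makes the output extensional on \<open>{..<n}\<close>. The procedure is
  meaningful for \<open>n, r > 0\<close>; otherwise one of the two uniform distributions is over an empty set and
  the result is some unspecified distribution.
\<close>

definition propagation_sampling ::
  "nat \<Rightarrow> nat \<Rightarrow> (nat set \<Rightarrow> (nat \<Rightarrow> nat) pmf) \<Rightarrow> (nat \<Rightarrow> nat) pmf" where
  "propagation_sampling n r \<mu> =
     bind_pmf (pmf_of_set {1..r}) (\<lambda>m.
     bind_pmf (pmf_of_set {vs. set vs \<subseteq> {..<n} \<and> length vs = m}) (\<lambda>vs.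
     let S = set vs in
     bind_pmf (\<mu> S) (\<lambda>y.
     map_pmf (\<lambda>z i. if i \<in> S then y i else z i)
       (Pi_pmf ({..<n} - S) undefined
          (\<lambda>i. map_pmf (\<lambda>x. x i) (cond_local \<mu> S y {i}))))))"

definition pair_dist :: "(nat \<Rightarrow> nat) pmf \<Rightarrow> nat \<Rightarrow> nat \<Rightarrow> (nat \<times> nat) pmf" where
  "pair_dist p i j = map_pmf (\<lambda>x. (x i, x j)) p"

definition l1_dist_on :: "'a set \<Rightarrow> 'a pmf \<Rightarrow> 'a pmf \<Rightarrow> real" where
  "l1_dist_on A P Q = (\<Sum>x\<in>A. \<bar>pmf P x - pmf Q x\<bar>)"

end

theory Submission
  imports Defs
begin

text \<open>
  Fix a seed \<open>(S, y)\<close> and let \<open>P\<close>, \<open>p\<close> be the conditional pair and single probabilities. Conditioning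
  on \<open>X\<^sub>j\<close> increases the collision probability \<open>\<Sum>\<^sub>a p\<^sub>i\<^sub>a\<^sup>2\<close> of \<open>X\<^sub>i\<close>, on average, by the gain
  \<open>\<Sum>\<^sub>a\<^sub>b Cov\<^sup>2 / p\<^sub>j\<^sub>b\<close>. Collision probabilities stay in \<open>[0, 1]\<close>, so the gain of a random pair, averaged
  over the \<open>r\<close> possible seed sizes, is at most \<open>1 / r\<close>.

  Conversely, local correlation forces a large gain. The kernel \<open>K\<^sub>i\<^sub>j = \<Sum>\<^sub>a\<^sub>b Cov\<^sup>2 / sqrt (p\<^sub>i\<^sub>a p\<^sub>j\<^sub>b)\<close> is
  entrywise nonnegative, positive semidefinite by the Schur product theorem, at most \<open>1\<close> on the
  diagonal, and bounded by the symmetrised gain, while \<open>(\<Sum>\<^sub>a\<^sub>b \<bar>Cov\<bar>)\<^sup>2 \<le> k K\<^sub>i\<^sub>j\<close>. After deleting the few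
  vertices whose row average of \<open>K\<close> exceeds \<open>H\<close>, the operator norm of \<open>K / n\<close> is at most \<open>H\<close>, hence
  splitting the spectrum of \<open>G\<close> at \<open>\<tau>\<close> bounds the average of \<open>K\<close> over the edges by \<open>\<tau> + rank H\<close>.
  Working with row averages instead of the Frobenius norm of \<open>K\<close> keeps the dependence on \<open>k\<close> linear.
\<close>

section \<open>Spectral theorem for real symmetric matrices\<close>

text \<open>Vectors are functions on \<open>nat\<close> of which only the coordinates below
  \<open>n\<close> count, so that the product topology of the function space can supply compactness
  later.\<close>

definition dotp :: "nat \<Rightarrow> (nat \<Rightarrow> real) \<Rightarrow> (nat \<Rightarrow> real) \<Rightarrow> real" where
  "dotp n x y = (\<Sum>i<n. x i * y i)"

definition mulvec :: "nat \<Rightarrow> (nat \<Rightarrow> nat \<Rightarrow> real) \<Rightarrow> (nat \<Rightarrow> real) \<Rightarrow> nat \<Rightarrow> real" where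
  "mulvec n A x = (\<lambda>i. \<Sum>j<n. A i j * x j)"

definition orthonormal_upto :: "nat \<Rightarrow> nat \<Rightarrow> (nat \<Rightarrow> nat \<Rightarrow> real) \<Rightarrow> bool" where
  "orthonormal_upto n m u \<longleftrightarrow> (\<forall>l<m. \<forall>l'<m. dotp n (u l) (u l') = of_bool (l = l'))"

lemma dotp_commute: "dotp n x y = dotp n y x"
  by (simp add: dotp_def mult.commute)

lemma dotp_add_left: "dotp n (\<lambda>i. x i + y i) z = dotp n x z + dotp n y z"
  by (simp add: dotp_def algebra_simps sum.distrib)

lemma dotp_diff_left: "dotp n (\<lambda>i. x i - y i) z = dotp n x z - dotp n y z"
  by (simp add: dotp_def algebra_simps sum_subtractf)

lemma dotp_scale_left: "dotp n (\<lambda>i. c * x i) z = c * dotp n x z"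
  by (simp add: dotp_def algebra_simps sum_distrib_left)

lemma dotp_sum_left: "dotp n (\<lambda>i. \<Sum>l\<in>L. f l i) z = (\<Sum>l\<in>L. dotp n (f l) z)"
  by (simp add: dotp_def sum_distrib_right) (rule sum.swap)

lemma dotp_add_right: "dotp n z (\<lambda>i. x i + y i) = dotp n z x + dotp n z y"
  by (simp add: dotp_def algebra_simps sum.distrib)

lemma dotp_diff_right: "dotp n z (\<lambda>i. x i - y i) = dotp n z x - dotp n z y"
  by (simp add: dotp_def algebra_simps sum_subtractf)

lemma dotp_scale_right: "dotp n z (\<lambda>i. c * x i) = c * dotp n z x"
  by (simp add: dotp_def algebra_simps sum_distrib_left)

lemma dotp_cong: "(\<And>i. i < n \<Longrightarrow> x i = x' i) \<Longrightarrow> (\<And>i. i < n \<Longrightarrow> y i = y' i) \<Longrightarrow> dotp n x y = dotp n x' y'"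
  by (simp add: dotp_def)

lemma dotp_self_nonneg: "dotp n x x \<ge> 0"
  by (simp add: dotp_def sum_nonneg)

lemma dotp_self_eq_0: "dotp n x x = 0 \<Longrightarrow> i < n \<Longrightarrow> x i = 0"
  by (simp add: dotp_def sum_nonneg_eq_0_iff)

lemma mulvec_add: "mulvec n A (\<lambda>i. x i + y i) = (\<lambda>i. mulvec n A x i + mulvec n A y i)"
  by (simp add: mulvec_def algebra_simps sum.distrib fun_eq_iff)

lemma mulvec_scale: "mulvec n A (\<lambda>i. c * x i) = (\<lambda>i. c * mulvec n A x i)"
  by (simp add: mulvec_def algebra_simps sum_distrib_left fun_eq_iff)

lemma dotp_mulvec_symmetric:
  assumes "\<And>i j. i < n \<Longrightarrow> j < n \<Longrightarrow> A i j = A j i"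
  shows "dotp n x (mulvec n A y) = dotp n (mulvec n A x) y"
proof -
  have "dotp n x (mulvec n A y) = (\<Sum>i<n. \<Sum>j<n. x i * A i j * y j)"
    by (simp add: dotp_def mulvec_def sum_distrib_left mult.assoc)
  also have "\<dots> = (\<Sum>j<n. \<Sum>i<n. x i * A i j * y j)" by (rule sum.swap)
  also have "\<dots> = (\<Sum>j<n. \<Sum>i<n. A j i * x i * y j)"
    using assms by (intro sum.cong refl) (simp add: mult.commute)
  also have "\<dots> = dotp n (mulvec n A x) y"
    by (simp add: dotp_def mulvec_def sum_distrib_right)
  finally show ?thesis .
qed

section \<open>Residuals of the standard basis vectors after projection onto an orthonormal
  family\<close>

definition residual_vec :: "nat \<Rightarrow> nat \<Rightarrow> (nat \<Rightarrow> nat \<Rightarrow> real) \<Rightarrow> nat \<Rightarrow> nat \<Rightarrow> real" where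
  "residual_vec n m u p = (\<lambda>i. of_bool (i = p) - (\<Sum>l<m. u l p * u l i))"

lemma dotp_unit: "p < n \<Longrightarrow> dotp n (\<lambda>i. of_bool (i = p)) x = x p"
  by (simp add: dotp_def of_bool_def if_distrib[of "\<lambda>t. t * _"] sum.delta cong: if_cong)

lemma residual_vec_orthogonal:
  assumes "orthonormal_upto n m u" "l < m" "p < n"
  shows "dotp n (residual_vec n m u p) (u l) = 0"
proof -
  have "dotp n (residual_vec n m u p) (u l) = u l p - (\<Sum>k<m. u k p * dotp n (u k) (u l))"
    using assms(3) by (simp add: residual_vec_def dotp_diff_left dotp_unit dotp_sum_left dotp_scale_left)
  also have "(\<Sum>k<m. u k p * dotp n (u k) (u l)) = (\<Sum>k<m. if k = l then u k p else 0)"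
    using assms by (intro sum.cong) (auto simp: orthonormal_upto_def)
  finally show ?thesis using assms(2) by simp
qed

text \<open>Pythagoras: the residual is orthogonal to the projection that was subtracted, so only
  its own coordinate \<open>p\<close> survives in the inner product with itself.\<close>

lemma residual_vec_norm:
  assumes "orthonormal_upto n m u" "p < n"
  shows "dotp n (residual_vec n m u p) (residual_vec n m u p) = 1 - (\<Sum>l<m. (u l p)\<^sup>2)"
proof -
  let ?r = "residual_vec n m u p"
  have "dotp n ?r ?r = dotp n (\<lambda>i. of_bool (i = p) - (\<Sum>l<m. u l p * u l i)) ?r"
    by (simp add: residual_vec_def)
  also have "\<dots> = ?r p - (\<Sum>l<m. u l p * dotp n (u l) ?r)"
    by (simp only: dotp_diff_left dotp_unit[OF assms(2)] dotp_sum_left dotp_scale_left)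
  also have "(\<Sum>l<m. u l p * dotp n (u l) ?r) = 0"
    using residual_vec_orthogonal[OF assms(1) _ assms(2)] by (simp add: dotp_commute)
  finally show ?thesis by (simp add: residual_vec_def power2_eq_square)
qed

text \<open>Counting squared entries by coordinate instead of by vector replaces dimension
  arguments: for \<open>m < n\<close> some basis vector has a nonzero residual, for
  \<open>m = n\<close> none has.\<close>

lemma orthonormal_sum_sqs:
  assumes "orthonormal_upto n m u"
  shows "(\<Sum>p<n. \<Sum>l<m. (u l p)\<^sup>2) = real m"
proof -
  have "(\<Sum>p<n. \<Sum>l<m. (u l p)\<^sup>2) = (\<Sum>l<m. dotp n (u l) (u l))"
    unfolding dotp_def power2_eq_square by (rule sum.swap)
  also have "\<dots> = (\<Sum>l<m. 1)" using assms by (intro sum.cong) (auto simp: orthonormal_upto_def)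
  finally show ?thesis by simp
qed

text \<open>The squared residual norms are nonnegative and add up to \<open>n - n = 0\<close>, so
  every residual vanishes.\<close>

lemma orthonormal_complete:
  assumes "orthonormal_upto n n u" "i < n" "p < n"
  shows "(\<Sum>l<n. u l p * u l i) = of_bool (i = p)"
proof -
  have nn: "0 \<le> 1 - (\<Sum>l<n. (u l q)\<^sup>2)" if "q < n" for q
    using residual_vec_norm[OF assms(1) that] dotp_self_nonneg by metis
  have "(\<Sum>q<n. 1 - (\<Sum>l<n. (u l q)\<^sup>2)) = 0"
    using orthonormal_sum_sqs[OF assms(1)] by (simp add: sum_subtractf)
  hence "1 - (\<Sum>l<n. (u l p)\<^sup>2) = 0"
    using nn assms(3) by (subst (asm) sum_nonneg_eq_0_iff) auto
  hence "dotp n (residual_vec n n u p) (residual_vec n n u p) = 0"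
    using residual_vec_norm[OF assms(1,3)] by simp
  from dotp_self_eq_0[OF this assms(2)] show ?thesis by (simp add: residual_vec_def)
qed

section \<open>Eigenvectors as maximisers of the Rayleigh quotient\<close>

lemma compact_box_fun: "compact {x :: nat \<Rightarrow> real. \<forall>i. \<bar>x i\<bar> \<le> (if i < n then 1 else 0)}"
proof -
  have "{x :: nat \<Rightarrow> real. \<forall>i. \<bar>x i\<bar> \<le> (if i < n then 1 else 0)}
      = PiE UNIV (\<lambda>i. {- (if i < n then 1 else 0) .. (if i < n then 1 else 0)})"
    by (auto simp: PiE_def Pi_def abs_le_iff)
  moreover have "compactin (product_topology (\<lambda>i. euclidean) UNIV)
      (PiE UNIV (\<lambda>i::nat. {- (if i < n then 1 else 0) .. (if i < n then 1 else (0::real))}))"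
    by (subst compactin_PiE) auto
  ultimately show ?thesis by (simp add: euclidean_product_topology)
qed

lemma continuous_on_dotp:
  assumes "\<And>i. i < n \<Longrightarrow> continuous_on S (\<lambda>x. f x i)" "\<And>i. i < n \<Longrightarrow> continuous_on S (\<lambda>x. g x i)"
  shows "continuous_on S (\<lambda>x. dotp n (f x) (g x))"
  unfolding dotp_def using assms by (intro continuous_on_sum continuous_on_mult) auto

lemma continuous_on_coord: "continuous_on S (\<lambda>x :: nat \<Rightarrow> real. x i)"
  by (rule continuous_on_product_coordinates[THEN continuous_on_subset]) auto

text \<open>Maximise \<open>dotp n x (mulvec n A x)\<close> over the unit vectors orthogonal to the
  eigenvectors found so far. Their complement \<open>W\<close> is invariant under \<open>A\<close>,
  hence a maximiser is an eigenvector and the maximum its eigenvalue.\<close>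

lemma next_eigenvector:
  assumes sym: "\<And>i j. i < n \<Longrightarrow> j < n \<Longrightarrow> A i j = A j i"
    and on: "orthonormal_upto n m u" and "m < n"
    and eig: "\<And>l i. l < m \<Longrightarrow> i < n \<Longrightarrow> mulvec n A (u l) i = lam l * u l i"
  obtains v c where "dotp n v v = 1" "\<And>l. l < m \<Longrightarrow> dotp n v (u l) = 0"
    "\<And>i. i < n \<Longrightarrow> mulvec n A v i = c * v i"
proof -
  define W where "W = {x. \<forall>l<m. dotp n x (u l) = 0}"
  \<comment> \<open>\<open>dotp\<close> does not see the coordinates from \<open>n\<close> on;
    pinning them to \<open>0\<close> makes the unit sphere a closed part of a product of compact
    intervals.\<close>
  define B where "B = {x :: nat \<Rightarrow> real. \<forall>i. \<bar>x i\<bar> \<le> (if i < n then 1 else 0)}"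
  define S where "S = B \<inter> ({x. dotp n x x = 1} \<inter> (\<Inter>l\<in>{..<m}. {x. dotp n x (u l) = 0}))"
  define q where "q x = dotp n x (mulvec n A x)" for x
  have S_iff: "x \<in> S \<longleftrightarrow> x \<in> B \<and> dotp n x x = 1 \<and> x \<in> W" for x
    by (auto simp: S_def W_def)
  have "closed ({x :: nat \<Rightarrow> real. dotp n x x = 1} \<inter> (\<Inter>l\<in>{..<m}. {x. dotp n x (u l) = 0}))"
    by (intro closed_Int closed_INT ballI closed_Collect_eq continuous_on_dotp continuous_on_coord
        continuous_on_const)
  hence "compact S" unfolding S_def B_def by (intro compact_Int_closed compact_box_fun)
  \<comment> \<open>Rescaling into \<open>S\<close> also cuts off the coordinates from
    \<open>n\<close> on, so \<open>x\<close> and \<open>t * y\<close> agree only below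
    \<open>n\<close>.\<close>
  have normalize: "\<exists>t>0. \<exists>y\<in>S. \<forall>i<n. x i = t * y i" if "x \<in> W" "dotp n x x > 0" for x
  proof -
    define t where "t = sqrt (dotp n x x)"
    have t: "t > 0" "t * t = dotp n x x" using that by (auto simp: t_def)
    define y where "y i = (if i < n then x i / t else 0)" for i
    have dy: "dotp n y z = dotp n x z / t" for z
      unfolding dotp_def y_def by (simp add: sum_divide_distrib)
    have "dotp n y y = 1"
      by (subst dy, subst dotp_commute, subst dy) (use t that(2) in simp)
    moreover have "y \<in> W" using that(1) by (simp add: W_def dy)
    moreover have "\<bar>y i\<bar> \<le> (if i < n then 1 else 0)" for i
    proof (cases "i < n")
      case True
      have "(y i)\<^sup>2 \<le> (\<Sum>j<n. (y j)\<^sup>2)" using True by (intro member_le_sum) auto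
      also have "\<dots> = 1" using \<open>dotp n y y = 1\<close> by (simp add: dotp_def power2_eq_square)
      finally show ?thesis using True by (simp add: abs_square_le_1)
    qed (simp add: y_def)
    ultimately have "y \<in> S" by (simp add: S_iff B_def)
    moreover have "\<forall>i<n. x i = t * y i" using t(1) by (simp add: y_def)
    ultimately show ?thesis using t(1) by blast
  qed
  have "S \<noteq> {}"
  proof -
    \<comment> \<open>If every standard basis vector lay in the span, the squared entries would
      total at least \<open>n\<close>, yet they total \<open>m < n\<close>.\<close>
    have "\<exists>p<n. (\<Sum>l<m. (u l p)\<^sup>2) < 1"
    proof (rule ccontr)
      assume "\<not> ?thesis"
      hence "(\<Sum>p<n. (1::real)) \<le> (\<Sum>p<n. \<Sum>l<m. (u l p)\<^sup>2)"
        by (intro sum_mono) (meson lessThan_iff not_less)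
      thus False using orthonormal_sum_sqs[OF on] \<open>m < n\<close> by simp
    qed
    then obtain p where p: "p < n" "(\<Sum>l<m. (u l p)\<^sup>2) < 1" by blast
    have "residual_vec n m u p \<in> W" using residual_vec_orthogonal[OF on _ p(1)] by (simp add: W_def)
    moreover have "dotp n (residual_vec n m u p) (residual_vec n m u p) > 0"
      using residual_vec_norm[OF on p(1)] p(2) by simp
    ultimately show ?thesis using normalize by blast
  qed
  have "continuous_on S q"
    unfolding q_def mulvec_def
    by (intro continuous_on_dotp continuous_on_coord continuous_on_sum continuous_on_mult continuous_on_const)
  from continuous_attains_sup[OF \<open>compact S\<close> \<open>S \<noteq> {}\<close> this]
  obtain v where v: "v \<in> S" and max: "\<And>y. y \<in> S \<Longrightarrow> q y \<le> q v" by blast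
  define c where "c = q v"
  \<comment> \<open>By homogeneity, maximality of \<open>v\<close> on \<open>S\<close> becomes
    nonnegativity of this quadratic form on all of \<open>W\<close>.\<close>
  define N where "N x = c * dotp n x x - q x" for x
  have q_cong: "q x = q y" if "\<And>i. i < n \<Longrightarrow> x i = y i" for x y
    unfolding q_def mulvec_def using that by (intro dotp_cong sum.cong) auto
  have N_nonneg: "N x \<ge> 0" if "x \<in> W" for x
  proof (cases "dotp n x x > 0")
    case True
    then obtain t y where ty: "t > 0" "y \<in> S" "\<And>i. i < n \<Longrightarrow> x i = t * y i"
      using normalize[OF \<open>x \<in> W\<close>] by blast
    have "q x = q (\<lambda>i. t * y i)" by (rule q_cong) (rule ty)
    also have "\<dots> = t * t * q y"
      by (simp add: q_def mulvec_scale dotp_scale_left dotp_scale_right)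
    finally have "q x = t * t * q y" .
    moreover have "dotp n x x = t * t"
    proof -
      have "dotp n x x = dotp n (\<lambda>i. t * y i) (\<lambda>i. t * y i)" by (rule dotp_cong) (rule ty, simp)+
      thus ?thesis using ty(2) by (simp add: dotp_scale_left dotp_scale_right S_iff)
    qed
    ultimately have "N x = t * t * (c - q y)" by (simp add: N_def algebra_simps)
    thus ?thesis using max[OF ty(2)] by (simp add: c_def)
  next
    case False
    hence "dotp n x x = 0" using dotp_self_nonneg[of n x] by linarith
    hence "\<And>i. i < n \<Longrightarrow> x i = 0" using dotp_self_eq_0 by blast
    hence "dotp n x x = 0 \<and> q x = 0" by (simp add: q_def dotp_def)
    thus ?thesis by (simp add: N_def)
  qed
  have vv: "dotp n v v = 1" and vW: "v \<in> W" using v by (auto simp: S_iff)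
  define w where "w = (\<lambda>i. c * v i - mulvec n A v i)"
  \<comment> \<open>Symmetry moves \<open>A\<close> onto the eigenvector \<open>u l\<close>; this
    keeps \<open>mulvec n A v\<close>, and hence \<open>w\<close>, inside \<open>W\<close>.\<close>
  have Av_u: "dotp n (mulvec n A v) (u l) = 0" if "l < m" for l
  proof -
    have "dotp n (mulvec n A v) (u l) = dotp n v (mulvec n A (u l))"
      by (rule dotp_mulvec_symmetric[of n A, OF sym, symmetric])
    also have "\<dots> = dotp n v (\<lambda>i. lam l * u l i)" using that eig by (intro dotp_cong) auto
    also have "\<dots> = 0" using vW that by (simp add: dotp_scale_right W_def)
    finally show ?thesis .
  qed
  have wW: "w \<in> W"
    using vW Av_u by (simp add: W_def w_def dotp_diff_left dotp_scale_left)
  text \<open>\<open>N\<close> is nonnegative on \<open>W\<close> and vanishes at \<open>v\<close>, so its first variation \<open>2 (w \<bullet> w)\<close> along \<open>w\<close> is \<open>0\<close>.\<close>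
  have expand: "N (\<lambda>i. v i + s * w i) = 2 * s * dotp n w w + s\<^sup>2 * N w" for s
  proof -
    have 1: "dotp n v (mulvec n A w) = dotp n w (mulvec n A v)"
      by (rule trans[OF dotp_mulvec_symmetric[of n A, OF sym] dotp_commute])
    have 2: "dotp n w w = c * dotp n w v - dotp n w (mulvec n A v)"
      using dotp_diff_right[of n w "\<lambda>i. c * v i" "mulvec n A v"]
      by (simp add: w_def[symmetric] dotp_scale_right)
    show ?thesis
      unfolding N_def q_def mulvec_add mulvec_scale dotp_add_left dotp_add_right
        dotp_scale_left dotp_scale_right 1 2
      using vv by (simp add: c_def q_def dotp_commute[of n v w] algebra_simps power2_eq_square)
  qed
  have "dotp n w w = 0"
  proof (rule ccontr)
    assume "dotp n w w \<noteq> 0"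
    hence pos: "dotp n w w > 0" using dotp_self_nonneg[of n w] by linarith
    \<comment> \<open>A negative step so short that the linear term wins: it turns
      \<open>2 * s * dotp n w w + s\<^sup>2 * (N w + 1)\<close> into
      \<open>s * dotp n w w < 0\<close>. The \<open>+ 1\<close> keeps the denominator
      positive.\<close>
    define s where "s = - dotp n w w / (N w + 1)"
    have Nw: "N w \<ge> 0" using wW by (rule N_nonneg)
    have "(\<lambda>i. v i + s * w i) \<in> W"
      using vW wW by (simp add: W_def dotp_add_left dotp_scale_left)
    from N_nonneg[OF this] have "0 \<le> 2 * s * dotp n w w + s\<^sup>2 * N w" by (simp add: expand)
    also have "\<dots> \<le> 2 * s * dotp n w w + s\<^sup>2 * (N w + 1)" by (simp add: mult_left_mono)
    also have "s\<^sup>2 * (N w + 1) = s * (s * (N w + 1))" by (simp add: power2_eq_square)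
    also have "s * (N w + 1) = - dotp n w w" using Nw by (simp add: s_def)
    also have "2 * s * dotp n w w + s * - dotp n w w = s * dotp n w w" by simp
    also have "\<dots> < 0" using pos Nw by (intro mult_neg_pos) (simp_all add: s_def)
    finally show False by simp
  qed
  hence "\<And>i. i < n \<Longrightarrow> w i = 0" using dotp_self_eq_0 by blast
  thus ?thesis using vv vW by (intro that[of v c]) (auto simp: W_def w_def)
qed

lemma orthonormal_eigenvectors:
  assumes sym: "\<And>i j. i < n \<Longrightarrow> j < n \<Longrightarrow> A i j = A j i" and "m \<le> n"
  shows "\<exists>u lam. orthonormal_upto n m u \<and> (\<forall>l<m. \<forall>i<n. mulvec n A (u l) i = lam l * u l i)"
  using \<open>m \<le> n\<close>
proof (induction m)
  case 0
  show ?case by (auto simp: orthonormal_upto_def)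
next
  case (Suc m)
  then obtain u lam where u: "orthonormal_upto n m u"
    "\<And>l i. l < m \<Longrightarrow> i < n \<Longrightarrow> mulvec n A (u l) i = lam l * u l i"
    by (auto simp: Suc_le_eq)
  from Suc.prems have "m < n" by simp
  from next_eigenvector[where A = A and lam = lam, OF sym u(1) this u(2)]
  obtain v c where v: "dotp n v v = 1" "\<And>l. l < m \<Longrightarrow> dotp n v (u l) = 0"
    "\<And>i. i < n \<Longrightarrow> mulvec n A v i = c * v i" by blast
  have v': "dotp n (u l) v = 0" if "l < m" for l
    using v(2)[OF that] by (simp add: dotp_commute)
  have "orthonormal_upto n (Suc m) (u(m := v))"
    using u(1) v(1,2) v' by (auto simp: orthonormal_upto_def less_Suc_eq)
  moreover have "\<forall>l<Suc m. \<forall>i<n. mulvec n A ((u(m := v)) l) i = (lam(m := c)) l * (u(m := v)) l i"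
    using u(2) v(3) by (auto simp: less_Suc_eq)
  ultimately show ?case by blast
qed

text \<open>The eigenvalue equation replaces \<open>lam l * u l i\<close> by row \<open>i\<close> of
  \<open>A\<close> applied to \<open>u l\<close>, and completeness of the basis collapses the double
  sum.\<close>

lemma eigendecomposition:
  assumes "orthonormal_upto n n u" "\<And>l i. l < n \<Longrightarrow> i < n \<Longrightarrow> mulvec n A (u l) i = lam l * u l i"
    and "i < n" "j < n"
  shows "A i j = (\<Sum>l<n. lam l * u l i * u l j)"
proof -
  have "(\<Sum>l<n. lam l * u l i * u l j) = (\<Sum>l<n. (\<Sum>p<n. A i p * u l p) * u l j)"
    using assms(2,3) by (intro sum.cong) (auto simp: mulvec_def)
  also have "\<dots> = (\<Sum>l<n. \<Sum>p<n. A i p * (u l j * u l p))"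
    by (simp add: sum_distrib_right) (simp add: mult_ac)
  also have "\<dots> = (\<Sum>p<n. \<Sum>l<n. A i p * (u l j * u l p))" by (rule sum.swap)
  also have "\<dots> = (\<Sum>p<n. A i p * of_bool (p = j))"
    using orthonormal_complete[OF assms(1) _ assms(4)]
    by (simp add: sum_distrib_left[symmetric])
  also have "\<dots> = A i j" using assms(4) by (simp add: of_bool_def if_distrib cong: if_cong)
  finally show ?thesis ..
qed

section \<open>Characteristic polynomial and count of large eigenvalues\<close>

lemma char_poly_eigenvectors:
  fixes A :: "real mat"
  assumes A: "A \<in> carrier_mat n n" and on: "orthonormal_upto n n u"
    and eig: "\<And>l i. l < n \<Longrightarrow> i < n \<Longrightarrow> mulvec n (\<lambda>i j. A $$ (i, j)) (u l) i = lam l * u l i"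
  shows "char_poly A = (\<Prod>l\<leftarrow>[0..<n]. [:- lam l, 1:])"
proof -
  define D where "D = mat n n (\<lambda>(i, j). if i = j then lam i else 0)"
  \<comment> \<open>The eigenvectors are the rows of \<open>U\<close>, so orthonormality is
    \<open>U * U\<^sup>T = 1\<^sub>m n\<close> and the eigendecomposition is a similarity to the
    diagonal matrix \<open>D\<close>.\<close>
  define U where "U = mat n n (\<lambda>(l, i). u l i)"
  have carr: "D \<in> carrier_mat n n" "U \<in> carrier_mat n n" "U\<^sup>T \<in> carrier_mat n n"
    by (auto simp: D_def U_def)
  have UU: "U * U\<^sup>T = 1\<^sub>m n"
    using on by (intro eq_matI)
      (auto simp: U_def scalar_prod_def orthonormal_upto_def dotp_def lessThan_atLeast0)
  have UU': "U\<^sup>T * U = 1\<^sub>m n" using mat_mult_left_right_inverse[OF carr(2,3) UU] .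
  have "A = U\<^sup>T * D * U"
  proof (intro eq_matI)
    fix i j assume "i < dim_row (U\<^sup>T * D * U)" "j < dim_col (U\<^sup>T * D * U)"
    hence ij: "i < n" "j < n" by (auto simp: U_def)
    have "(U\<^sup>T * D) $$ (i, l) = lam l * u l i" if "l < n" for l
      using ij that by (simp add: U_def D_def scalar_prod_def if_distrib mult.commute cong: if_cong)
    hence "(U\<^sup>T * D * U) $$ (i, j) = (\<Sum>l<n. lam l * u l i * u l j)"
      using ij carr by (simp add: scalar_prod_def U_def D_def lessThan_atLeast0)
    thus "A $$ (i, j) = (U\<^sup>T * D * U) $$ (i, j)" using eigendecomposition[OF on eig ij] by simp
  qed (use A in \<open>auto simp: U_def\<close>)
  hence "similar_mat A D"
    unfolding similar_mat_def similar_mat_wit_def Let_def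
    using A carr UU UU' by (intro exI[of _ "U\<^sup>T"] exI[of _ U]) auto
  hence "char_poly A = char_poly D" by (rule char_poly_similar)
  also have "\<dots> = (\<Prod>a\<leftarrow>diag_mat D. [:- a, 1:])"
    by (rule char_poly_upper_triangular[OF carr(1)]) (auto simp: D_def)
  also have "diag_mat D = map lam [0..<n]" by (auto simp: diag_mat_def D_def)
  finally show ?thesis by (simp add: o_def)
qed

text \<open>The bridge from roots of the characteristic polynomial, which define
  \<open>threshold_rank\<close>, to the eigenvectors with which the estimates work.\<close>

lemma threshold_rank_eigenvectors:
  fixes A :: "real mat"
  assumes "A \<in> carrier_mat n n" "orthonormal_upto n n u"
    and "\<And>l i. l < n \<Longrightarrow> i < n \<Longrightarrow> mulvec n (\<lambda>i j. A $$ (i, j)) (u l) i = lam l * u l i"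
  shows "threshold_rank \<tau> A = card {l. l < n \<and> lam l > \<tau>}"
proof -
  have "proots (\<Prod>l\<leftarrow>xs. [:- lam l, 1:]) = image_mset lam (mset xs)" for xs
    by (induction xs) (simp_all add: proots_mult prod_list_zero_iff image_iff del: mult_pCons_left)
  hence "proots (char_poly A) = image_mset lam (mset [0..<n])"
    using char_poly_eigenvectors[OF assms] by simp
  also have "\<dots> = image_mset lam (mset_set {..<n})" by (simp add: lessThan_atLeast0)
  finally show ?thesis
    by (simp add: threshold_rank_def filter_mset_image_mset size_image_mset lessThan_def)
qed

section \<open>Schur product theorem\<close>

lemma quad_form_insert:
  fixes M :: "'i \<Rightarrow> 'i \<Rightarrow> real"
  assumes "finite I" "x \<notin> I" "\<And>q. q \<in> I \<Longrightarrow> M q x = M x q"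
  shows "(\<Sum>p\<in>insert x I. \<Sum>q\<in>insert x I. z p * M p q * z q)
    = (z x)\<^sup>2 * M x x + 2 * z x * (\<Sum>q\<in>I. M x q * z q) + (\<Sum>p\<in>I. \<Sum>q\<in>I. z p * M p q * z q)"
proof -
  have "(\<Sum>p\<in>I. z p * M p x * z x) = z x * (\<Sum>q\<in>I. M x q * z q)"
    unfolding sum_distrib_left using assms(3) by (intro sum.cong) auto
  moreover have "(\<Sum>q\<in>I. z x * M x q * z q) = z x * (\<Sum>q\<in>I. M x q * z q)"
    by (simp add: sum_distrib_left mult.assoc)
  ultimately show ?thesis
    using assms(1,2) by (simp add: sum.distrib power2_eq_square algebra_simps)
qed

lemma pos_semidef_on_gram:
  fixes M :: "'i \<Rightarrow> 'i \<Rightarrow> real"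
  assumes "finite I" "pos_semidef_on I M"
  shows "\<exists>f. \<forall>p\<in>I. \<forall>q\<in>I. M p q = (\<Sum>s\<in>I. f s p * f s q :: real)"
  using assms
proof (induction I arbitrary: M rule: finite_induct)
  case empty
  show ?case by simp
next
  case (insert x I)
  let ?F = "insert x I"
  have sym: "M p q = M q p" if "p \<in> ?F" "q \<in> ?F" for p q
    using insert.prems that unfolding pos_semidef_on_def by blast
  have psd: "0 \<le> (z x)\<^sup>2 * M x x + 2 * z x * (\<Sum>q\<in>I. M x q * z q) + (\<Sum>p\<in>I. \<Sum>q\<in>I. z p * M p q * z q)" for z
  proof -
    have "\<forall>z. 0 \<le> (\<Sum>p\<in>?F. \<Sum>q\<in>?F. z p * M p q * z q)"
      using insert.prems unfolding pos_semidef_on_def by (rule conjunct2)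
    hence "0 \<le> (\<Sum>p\<in>?F. \<Sum>q\<in>?F. z p * M p q * z q)" by (rule spec)
    also have "\<dots> = (z x)\<^sup>2 * M x x + 2 * z x * (\<Sum>q\<in>I. M x q * z q) + (\<Sum>p\<in>I. \<Sum>q\<in>I. z p * M p q * z q)"
      by (rule quad_form_insert[OF insert.hyps], rule sym) simp_all
    finally show ?thesis .
  qed
  \<comment> \<open>The coordinate at \<open>x\<close> becomes a free parameter \<open>t\<close>, to
    be optimised for fixed \<open>z\<close>.\<close>
  have quad: "0 \<le> t\<^sup>2 * M x x + 2 * t * (\<Sum>q\<in>I. M x q * z q) + (\<Sum>p\<in>I. \<Sum>q\<in>I. z p * M p q * z q)" for t z
  proof -
    have "(\<Sum>q\<in>I. M x q * (z(x := t)) q) = (\<Sum>q\<in>I. M x q * z q)"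
      "(\<Sum>p\<in>I. \<Sum>q\<in>I. (z(x := t)) p * M p q * (z(x := t)) q) = (\<Sum>p\<in>I. \<Sum>q\<in>I. z p * M p q * z q)"
      using insert.hyps(2) by (auto intro!: sum.cong)
    thus ?thesis using psd[of "z(x := t)"] by simp
  qed
  have xx: "M x x \<ge> 0" using quad[of 1 "\<lambda>_. 0"] by simp
  \<comment> \<open>A vanishing diagonal entry forces its row to vanish, since otherwise the form is
    linear in \<open>t\<close> and unbounded below. The \<open>t\<close> chosen here gives the value
    \<open>-1\<close>.\<close>
  have zero: "M x q = 0" if "M x x = 0" "q \<in> I" for q
  proof (rule ccontr)
    assume nz: "M x q \<noteq> 0"
    define t where "t = - (M q q + 1) / (2 * M x q)"
    have right: "c * of_bool (r = q) = (if r = q then c else 0)"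
      and left: "of_bool (r = q) * c = (if r = q then c else 0)" for c :: real and r by simp_all
    have "(\<Sum>p\<in>I. \<Sum>r\<in>I. of_bool (p = q) * M p r * of_bool (r = q)) = (\<Sum>p\<in>I. if p = q then M p q else 0)"
      unfolding right using insert.hyps(1) that(2) by (simp add: left)
    hence "(\<Sum>p\<in>I. \<Sum>r\<in>I. of_bool (p = q) * M p r * of_bool (r = q)) = M q q"
      using insert.hyps(1) that(2) by simp
    moreover have "(\<Sum>r\<in>I. M x r * of_bool (r = q)) = M x q"
      unfolding right using insert.hyps(1) that(2) by simp
    ultimately have "0 \<le> 2 * t * M x q + M q q"
      using quad[of t "\<lambda>r. of_bool (r = q)"] that(1) by simp
    also have "2 * t * M x q = - (M q q + 1)" using nz by (simp add: t_def)
    finally show False by simp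
  qed
  \<comment> \<open>If \<open>M x x = 0\<close>, division by zero makes \<open>g\<close> zero, in
    agreement with the vanishing row.\<close>
  define g where "g p = M x p / sqrt (M x x)" for p
  have gx: "g x * g q = M x q" if "q \<in> ?F" for q
  proof (cases "M x x = 0")
    case True
    thus ?thesis using zero that by (auto simp: g_def)
  next
    case False
    thus ?thesis using xx by (simp add: g_def field_simps)
  qed
  have "pos_semidef_on I (\<lambda>p q. M p q - g p * g q)"
    unfolding pos_semidef_on_def
  proof safe
    fix p q assume "p \<in> I" "q \<in> I"
    thus "M p q - g p * g q = M q p - g q * g p" using sym[of p q] by simp
  next
    fix z :: "'i \<Rightarrow> real"
    define b where "b = (\<Sum>q\<in>I. M x q * z q)"
    have gz: "(\<Sum>q\<in>I. g q * z q) = b / sqrt (M x x)"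
      by (simp add: g_def b_def sum_divide_distrib)
    have "(\<Sum>p\<in>I. \<Sum>q\<in>I. z p * (M p q - g p * g q) * z q)
        = (\<Sum>p\<in>I. \<Sum>q\<in>I. z p * M p q * z q) - (\<Sum>p\<in>I. g p * z p) * (\<Sum>q\<in>I. g q * z q)"
      by (simp add: sum_product sum_subtractf algebra_simps)
    also have "\<dots> = (\<Sum>p\<in>I. \<Sum>q\<in>I. z p * M p q * z q) - b\<^sup>2 / M x x"
      using xx by (simp add: gz power2_eq_square)
    also have "\<dots> \<ge> 0"
    proof (cases "M x x = 0")
      case True
      thus ?thesis using quad[of 0 z] by simp
    next
      case False
      \<comment> \<open>\<open>- b / M x x\<close> minimises the quadratic in \<open>t\<close>; the
        minimum is the form of the Schur complement.\<close>
      have "(- b / M x x)\<^sup>2 * M x x + 2 * (- b / M x x) * b = - (b\<^sup>2 / M x x)"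
        using False by (simp add: power2_eq_square field_simps)
      thus ?thesis using quad[of "- b / M x x" z] by (simp add: b_def[symmetric])
    qed
    finally show "0 \<le> (\<Sum>p\<in>I. \<Sum>q\<in>I. z p * (M p q - g p * g q) * z q)" .
  qed
  from insert.IH[OF this] obtain f where
    f: "\<And>p q. p \<in> I \<Longrightarrow> q \<in> I \<Longrightarrow> M p q - g p * g q = (\<Sum>s\<in>I. f s p * f s q)" by blast
  \<comment> \<open>The new vector, indexed by \<open>x\<close>, is \<open>g\<close>; the old ones
    are extended by \<open>0\<close> at \<open>x\<close>.\<close>
  define h where "h s p = (if s = x then g p else if p = x then 0 else f s p)" for s p
  have "M p q = (\<Sum>s\<in>?F. h s p * h s q)" if pq: "p \<in> ?F" "q \<in> ?F" for p q
  proof -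
    have "(\<Sum>s\<in>?F. h s p * h s q) = g p * g q + (\<Sum>s\<in>I. h s p * h s q)"
      using insert.hyps by (simp add: h_def)
    also have "(\<Sum>s\<in>I. h s p * h s q) = (if p = x \<or> q = x then 0 else (\<Sum>s\<in>I. f s p * f s q))"
      using insert.hyps(2) by (auto simp: h_def intro!: sum.neutral sum.cong)
    also have "g p * g q + \<dots> = M p q"
    proof (cases "p = x \<or> q = x")
      case True
      thus ?thesis using gx pq sym[of p q] by (auto simp: mult.commute)
    next
      case False
      thus ?thesis using f[of p q] pq by simp
    qed
    finally show ?thesis by simp
  qed
  thus ?case by blast
qed

text \<open>Given Gram vectors \<open>f s\<close>, the entrywise square has the Gram vectors
  \<open>f s * f t\<close> indexed by pairs, so its form is a sum of squares.\<close>

lemma schur_product_square_nonneg: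
  fixes M :: "'i \<Rightarrow> 'i \<Rightarrow> real"
  assumes "finite I" "pos_semidef_on I M"
  shows "0 \<le> (\<Sum>p\<in>I. \<Sum>q\<in>I. z p * (M p q)\<^sup>2 * z q)"
proof -
  obtain f where f: "\<And>p q. p \<in> I \<Longrightarrow> q \<in> I \<Longrightarrow> M p q = (\<Sum>s\<in>I. f s p * f s q :: real)"
    using pos_semidef_on_gram[OF assms] by blast
  have "(\<Sum>p\<in>I. \<Sum>q\<in>I. z p * (M p q)\<^sup>2 * z q)
      = (\<Sum>p\<in>I. \<Sum>q\<in>I. \<Sum>s\<in>I. \<Sum>t\<in>I. (z p * f s p * f t p) * (z q * f s q * f t q))"
  proof (intro sum.cong refl)
    fix p q assume "p \<in> I" "q \<in> I"
    hence "(M p q)\<^sup>2 = (\<Sum>s\<in>I. \<Sum>t\<in>I. (f s p * f s q) * (f t p * f t q))"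
      using f by (simp add: power2_eq_square sum_product)
    thus "z p * (M p q)\<^sup>2 * z q = (\<Sum>s\<in>I. \<Sum>t\<in>I. (z p * f s p * f t p) * (z q * f s q * f t q))"
      by (simp add: sum_distrib_left sum_distrib_right mult_ac)
  qed
  also have "\<dots> = (\<Sum>p\<in>I. \<Sum>s\<in>I. \<Sum>t\<in>I. \<Sum>q\<in>I. (z p * f s p * f t p) * (z q * f s q * f t q))"
    by (rule sum.cong[OF refl], rule trans[OF sum.swap], rule sum.cong[OF refl], rule sum.swap)
  also have "\<dots> = (\<Sum>s\<in>I. \<Sum>t\<in>I. \<Sum>p\<in>I. \<Sum>q\<in>I. (z p * f s p * f t p) * (z q * f s q * f t q))"
    by (rule trans[OF sum.swap], rule sum.cong[OF refl], rule sum.swap)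
  also have "\<dots> = (\<Sum>s\<in>I. \<Sum>t\<in>I. (\<Sum>p\<in>I. z p * f s p * f t p)\<^sup>2)"
    by (simp add: power2_eq_square sum_product)
  also have "\<dots> \<ge> 0" by (intro sum_nonneg) simp
  finally show ?thesis .
qed

section \<open>Threshold rank and quadratic forms\<close>

text \<open>Schur's test: \<open>2 * x i * x j\<close> is at most the sum of the squares, and by
  symmetry the row sums control both halves.\<close>

lemma quad_form_le_row_sum:
  fixes M :: "nat \<Rightarrow> nat \<Rightarrow> real"
  assumes sym: "\<And>i j. i < n \<Longrightarrow> j < n \<Longrightarrow> M i j = M j i"
    and nonneg: "\<And>i j. i < n \<Longrightarrow> j < n \<Longrightarrow> 0 \<le> M i j"
    and row: "\<And>i. i < n \<Longrightarrow> (\<Sum>j<n. M i j) \<le> B"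
  shows "(\<Sum>i<n. \<Sum>j<n. M i j * (x i * x j)) \<le> B * dotp n x x"
proof -
  have half: "(\<Sum>i<n. \<Sum>j<n. M i j * (x i)\<^sup>2) \<le> B * dotp n x x"
  proof -
    have "(\<Sum>i<n. \<Sum>j<n. M i j * (x i)\<^sup>2) = (\<Sum>i<n. (\<Sum>j<n. M i j) * (x i)\<^sup>2)"
      by (simp add: sum_distrib_right)
    also have "\<dots> \<le> (\<Sum>i<n. B * (x i)\<^sup>2)" using row by (intro sum_mono mult_right_mono) auto
    finally show ?thesis by (simp add: dotp_def sum_distrib_left power2_eq_square)
  qed
  have swap: "(\<Sum>i<n. \<Sum>j<n. M i j * (x j)\<^sup>2) = (\<Sum>i<n. \<Sum>j<n. M i j * (x i)\<^sup>2)"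
    using sym by (subst sum.swap) (auto intro!: sum.cong)
  have "(\<Sum>i<n. \<Sum>j<n. M i j * (x i * x j)) \<le> (\<Sum>i<n. \<Sum>j<n. M i j * (((x i)\<^sup>2 + (x j)\<^sup>2) / 2))"
  proof (intro sum_mono mult_left_mono)
    fix i j
    show "x i * x j \<le> ((x i)\<^sup>2 + (x j)\<^sup>2) / 2" using sum_squares_bound[of "x i" "x j"] by simp
  qed (use nonneg in auto)
  also have "\<dots> = ((\<Sum>i<n. \<Sum>j<n. M i j * (x i)\<^sup>2) + (\<Sum>i<n. \<Sum>j<n. M i j * (x j)\<^sup>2)) / 2"
    by (simp add: sum.distrib[symmetric] sum_divide_distrib algebra_simps)
  finally show ?thesis using half swap by simp
qed

lemma regular_graph_eigenvectors:
  assumes "regular_graph n G"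
  obtains u lam where "orthonormal_upto n n u"
    "\<And>l i. l < n \<Longrightarrow> i < n \<Longrightarrow> mulvec n (\<lambda>i j. G $$ (i, j)) (u l) i = lam l * u l i"
proof -
  have "G $$ (i, j) = G $$ (j, i)" if "i < n" "j < n" for i j
    using assms that unfolding regular_graph_def by blast
  from orthonormal_eigenvectors[of n "\<lambda>i j. G $$ (i, j)", OF this order_refl] that
  show ?thesis by blast
qed

lemma quad_form_mulvec:
  "(\<Sum>i<n. \<Sum>j<n. A i j * (x i * x j)) = dotp n x (mulvec n A x)"
  by (simp add: dotp_def mulvec_def sum_distrib_left mult_ac)

lemma regular_graph_eigenvalue_le_1:
  assumes G: "regular_graph n G" and on: "orthonormal_upto n n u" and l: "l < n"
    and eig: "\<And>i. i < n \<Longrightarrow> mulvec n (\<lambda>i j. G $$ (i, j)) (u l) i = c * u l i"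
  shows "c \<le> 1"
proof -
  have uu: "dotp n (u l) (u l) = 1" using on l by (simp add: orthonormal_upto_def)
  have "c = dotp n (u l) (\<lambda>i. c * u l i)" using uu by (simp add: dotp_scale_right)
  also have "\<dots> = dotp n (u l) (mulvec n (\<lambda>i j. G $$ (i, j)) (u l))"
    using eig by (intro dotp_cong) auto
  also have "\<dots> \<le> 1 * dotp n (u l) (u l)"
    unfolding quad_form_mulvec[symmetric]
    using G by (intro quad_form_le_row_sum) (auto simp: regular_graph_def)
  finally show ?thesis using uu by simp
qed

text \<open>The trace inner product of \<open>A\<close> and \<open>K\<close>, evaluated in an
  eigenbasis of \<open>A\<close>.\<close>

lemma eigen_sum_quad_forms:
  assumes on: "orthonormal_upto n n u"
    and eig: "\<And>l i. l < n \<Longrightarrow> i < n \<Longrightarrow> mulvec n A (u l) i = lam l * u l i"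
  shows "(\<Sum>i<n. \<Sum>j<n. A i j * K i j) = (\<Sum>l<n. lam l * (\<Sum>i<n. \<Sum>j<n. K i j * (u l i * u l j)))"
proof -
  have "(\<Sum>i<n. \<Sum>j<n. A i j * K i j) = (\<Sum>i<n. \<Sum>j<n. \<Sum>l<n. lam l * (K i j * (u l i * u l j)))"
  proof (intro sum.cong refl)
    fix i j assume "i \<in> {..<n}" "j \<in> {..<n}"
    hence "A i j = (\<Sum>l<n. lam l * u l i * u l j)" using eigendecomposition[OF on eig] by simp
    thus "A i j * K i j = (\<Sum>l<n. lam l * (K i j * (u l i * u l j)))"
      by (simp add: sum_distrib_left sum_distrib_right mult_ac)
  qed
  also have "\<dots> = (\<Sum>i<n. \<Sum>l<n. \<Sum>j<n. lam l * (K i j * (u l i * u l j)))"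
    by (rule sum.cong[OF refl], rule sum.swap)
  also have "\<dots> = (\<Sum>l<n. \<Sum>i<n. \<Sum>j<n. lam l * (K i j * (u l i * u l j)))" by (rule sum.swap)
  finally show ?thesis by (simp add: sum_distrib_left)
qed

text \<open>In the eigenbasis of \<open>G\<close> the forms \<open>q l\<close> of \<open>K\<close>
  are nonnegative, at most \<open>B\<close> each, and sum to the trace. Eigenvalues above
  \<open>\<tau>\<close> are at most \<open>1\<close> and add at most \<open>B\<close> apiece; the
  rest is bounded by \<open>\<tau>\<close> times the trace.\<close>

lemma graph_inner_product_le:
  assumes G: "regular_graph n G" and "\<tau> \<ge> 0"
    and sym: "\<And>i j. i < n \<Longrightarrow> j < n \<Longrightarrow> K i j = K j i"
    and nonneg: "\<And>i j. i < n \<Longrightarrow> j < n \<Longrightarrow> 0 \<le> K i j"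
    and row: "\<And>i. i < n \<Longrightarrow> (\<Sum>j<n. K i j) \<le> B"
    and psd: "\<And>z. 0 \<le> (\<Sum>i<n. \<Sum>j<n. K i j * (z i * z j))"
  shows "(\<Sum>i<n. \<Sum>j<n. G $$ (i, j) * K i j) \<le> \<tau> * (\<Sum>i<n. K i i) + real (threshold_rank \<tau> G) * B"
proof -
  obtain u lam where on: "orthonormal_upto n n u"
    and eig: "\<And>l i. l < n \<Longrightarrow> i < n \<Longrightarrow> mulvec n (\<lambda>i j. G $$ (i, j)) (u l) i = lam l * u l i"
    using regular_graph_eigenvectors[OF G] by blast
  have G': "G \<in> carrier_mat n n" using G by (simp add: regular_graph_def)
  define q where "q l = (\<Sum>i<n. \<Sum>j<n. K i j * (u l i * u l j))" for l
  have q0: "0 \<le> q l" for l using psd[of "u l"] by (simp add: q_def)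
  have qB: "q l \<le> B" if "l < n" for l
  proof -
    have "dotp n (u l) (u l) = 1" using on that by (simp add: orthonormal_upto_def)
    thus ?thesis using quad_form_le_row_sum[of n K B "u l", OF sym nonneg row] by (simp add: q_def)
  qed
  have "(\<Sum>l<n. q l) = (\<Sum>i<n. \<Sum>j<n. K i j * (\<Sum>l<n. u l i * u l j))"
    unfolding q_def sum_distrib_left
    by (rule trans[OF sum.swap], rule sum.cong[OF refl], rule sum.swap)
  also have "\<dots> = (\<Sum>i<n. \<Sum>j<n. K i j * of_bool (j = i))"
    using orthonormal_complete[OF on] by (intro sum.cong refl) auto
  also have "\<dots> = (\<Sum>i<n. K i i)"
    by (simp add: of_bool_def if_distrib cong: if_cong)
  finally have trace: "(\<Sum>l<n. q l) = (\<Sum>i<n. K i i)" .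
  have "(\<Sum>i<n. \<Sum>j<n. G $$ (i, j) * K i j) = (\<Sum>l<n. lam l * q l)"
    unfolding q_def using eigen_sum_quad_forms[OF on eig] by simp
  also have "\<dots> \<le> (\<Sum>l<n. \<tau> * q l + (if lam l > \<tau> then B else 0))"
  proof (intro sum_mono)
    fix l assume "l \<in> {..<n}"
    hence l: "l < n" by simp
    show "lam l * q l \<le> \<tau> * q l + (if lam l > \<tau> then B else 0)"
    proof (cases "lam l > \<tau>")
      case True
      have "lam l * q l \<le> 1 * q l"
        using regular_graph_eigenvalue_le_1[OF G on l eig[OF l]] q0 by (intro mult_right_mono) auto
      thus ?thesis using True qB[OF l] mult_nonneg_nonneg[OF \<open>\<tau> \<ge> 0\<close> q0[of l]] by simp
    next
      case False
      thus ?thesis using q0 by (simp add: mult_right_mono)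
    qed
  qed
  also have "\<dots> = \<tau> * (\<Sum>i<n. K i i) + real (card {l. l < n \<and> lam l > \<tau>}) * B"
  proof -
    have "{..<n} \<inter> {l. lam l > \<tau>} = {l. l < n \<and> lam l > \<tau>}" by auto
    thus ?thesis by (simp add: sum.distrib sum_distrib_left[symmetric] trace sum.If_cases)
  qed
  also have "card {l. l < n \<and> lam l > \<tau>} = threshold_rank \<tau> G"
    using threshold_rank_eigenvectors[OF G' on eig] by simp
  finally show ?thesis .
qed

text \<open>Pairing \<open>G\<close> with the all-ones matrix gives \<open>n\<close>, but at most
  \<open>\<tau> * n\<close> if no eigenvalue exceeds \<open>\<tau>\<close>. Later the rank appears
  as a divisor.\<close>

lemma threshold_rank_pos:
  assumes G: "regular_graph n G" and "0 < n" "\<tau> < 1"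
  shows "0 < threshold_rank \<tau> G"
proof (rule ccontr)
  assume "\<not> ?thesis"
  hence "threshold_rank \<tau> G = 0" by simp
  obtain u lam where on: "orthonormal_upto n n u"
    and eig: "\<And>l i. l < n \<Longrightarrow> i < n \<Longrightarrow> mulvec n (\<lambda>i j. G $$ (i, j)) (u l) i = lam l * u l i"
    using regular_graph_eigenvectors[OF G] by blast
  have G': "G \<in> carrier_mat n n" using G by (simp add: regular_graph_def)
  have "{l. l < n \<and> lam l > \<tau>} = {}"
    using threshold_rank_eigenvectors[OF G' on eig, of \<tau>] \<open>threshold_rank \<tau> G = 0\<close> by simp
  hence le: "lam l \<le> \<tau>" if "l < n" for l
    using that by (metis (mono_tags, lifting) empty_iff mem_Collect_eq not_less)
  have "real n = (\<Sum>i<n. \<Sum>j<n. G $$ (i, j) * 1)"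
    using G by (simp add: regular_graph_def)
  also have "\<dots> = (\<Sum>l<n. lam l * (\<Sum>i<n. \<Sum>j<n. 1 * (u l i * u l j)))"
    by (rule eigen_sum_quad_forms[OF on eig])
  also have "\<dots> \<le> (\<Sum>l<n. \<tau> * (\<Sum>i<n. \<Sum>j<n. 1 * (u l i * u l j)))"
  proof (intro sum_mono mult_right_mono)
    fix l
    have "(\<Sum>i<n. \<Sum>j<n. 1 * (u l i * u l j)) = (\<Sum>i<n. u l i)\<^sup>2"
      by (simp add: power2_eq_square sum_product)
    thus "0 \<le> (\<Sum>i<n. \<Sum>j<n. 1 * (u l i * u l j))" by simp
  qed (use le in auto)
  also have "\<dots> = \<tau> * (\<Sum>l<n. \<Sum>i<n. \<Sum>j<n. u l i * u l j)"
    by (simp only: mult_1 sum_distrib_left)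
  also have "(\<Sum>l<n. \<Sum>i<n. \<Sum>j<n. u l i * u l j) = (\<Sum>i<n. \<Sum>j<n. \<Sum>l<n. u l i * u l j)"
    by (rule trans[OF sum.swap], rule sum.cong[OF refl], rule sum.swap)
  also have "(\<Sum>i<n. \<Sum>j<n. \<Sum>l<n. u l i * u l j) = (\<Sum>i<n. \<Sum>j<n. of_bool (j = i))"
    using orthonormal_complete[OF on] by (intro sum.cong refl) auto
  also have "\<dots> = real n" by (simp add: of_bool_def)
  finally show False using assms(2,3) by simp
qed

section \<open>Local correlation versus gain\<close>

text \<open>Isolates the properties of the conditional pair and single probabilities of one seed.
  Pairs with \<open>i = j\<close> are included because the diagonal of the kernel enters the
  trace.\<close>

locale pairwise_marginals =
  fixes n k :: nat and P :: "nat \<times> nat \<Rightarrow> nat \<times> nat \<Rightarrow> real" and p :: "nat \<times> nat \<Rightarrow> real"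
  assumes P_nonneg: "i < n \<Longrightarrow> j < n \<Longrightarrow> a < k \<Longrightarrow> b < k \<Longrightarrow> 0 \<le> P (i, a) (j, b)"
    and P_sym: "i < n \<Longrightarrow> j < n \<Longrightarrow> a < k \<Longrightarrow> b < k \<Longrightarrow> P (i, a) (j, b) = P (j, b) (i, a)"
    and P_marginal: "i < n \<Longrightarrow> j < n \<Longrightarrow> a < k \<Longrightarrow> (\<Sum>b<k. P (i, a) (j, b)) = p (i, a)"
    and p_total: "i < n \<Longrightarrow> (\<Sum>a<k. p (i, a)) = 1"
begin

definition cov :: "nat \<times> nat \<Rightarrow> nat \<times> nat \<Rightarrow> real" where
  "cov x y = P x y - p x * p y"

text \<open>The l1 distance between the pair distribution and the product of its marginals.\<close>

definition corr :: "nat \<Rightarrow> nat \<Rightarrow> real" where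
  "corr i j = (\<Sum>a<k. \<Sum>b<k. \<bar>cov (i, a) (j, b)\<bar>)"

definition gain :: "nat \<Rightarrow> nat \<Rightarrow> real" where
  "gain i j = (\<Sum>a<k. \<Sum>b<k. (cov (i, a) (j, b))\<^sup>2 / p (j, b))"

text \<open>The geometric mean in the denominator splits into one factor per index, which preserves
  symmetry and positive semidefiniteness; the denominator of \<open>gain\<close> is not
  symmetric.\<close>

definition kernel :: "nat \<Rightarrow> nat \<Rightarrow> real" where
  "kernel i j = (\<Sum>a<k. \<Sum>b<k. (cov (i, a) (j, b))\<^sup>2 / sqrt (p (i, a) * p (j, b)))"

lemma P_le_left:
  assumes "i < n" "j < n" "a < k" "b < k"
  shows "P (i, a) (j, b) \<le> p (i, a)"
proof -
  have "P (i, a) (j, b) \<le> (\<Sum>b<k. P (i, a) (j, b))"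
    using assms P_nonneg by (intro member_le_sum) auto
  thus ?thesis using P_marginal assms by simp
qed

lemma P_le_right: "i < n \<Longrightarrow> j < n \<Longrightarrow> a < k \<Longrightarrow> b < k \<Longrightarrow> P (i, a) (j, b) \<le> p (j, b)"
  using P_le_left[of j i b a] P_sym[of i j a b] by simp

lemma p_nonneg: "i < n \<Longrightarrow> a < k \<Longrightarrow> 0 \<le> p (i, a)"
  using P_nonneg[of i i a a] P_le_left[of i i a a] by simp

lemma cov_sym: "i < n \<Longrightarrow> j < n \<Longrightarrow> a < k \<Longrightarrow> b < k \<Longrightarrow> cov (i, a) (j, b) = cov (j, b) (i, a)"
  by (simp add: cov_def P_sym mult.commute)

text \<open>Together with \<open>x / 0 = 0\<close> this makes letters of probability zero harmless
  in the quotients of \<open>gain\<close> and \<open>kernel\<close>.\<close>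

lemma P_eq_0:
  assumes "i < n" "j < n" "a < k" "b < k" "p (i, a) = 0 \<or> p (j, b) = 0"
  shows "P (i, a) (j, b) = 0"
  using assms P_nonneg[of i j a b] P_le_left[of i j a b] P_le_right[of i j a b] by auto

lemma cov_eq_0:
  assumes "i < n" "j < n" "a < k" "b < k" "p (i, a) = 0 \<or> p (j, b) = 0"
  shows "cov (i, a) (j, b) = 0"
  using P_eq_0[OF assms] assms(5) by (auto simp: cov_def)

lemma corr_le_2:
  assumes "i < n" "j < n"
  shows "corr i j \<le> 2"
proof -
  have "corr i j \<le> (\<Sum>a<k. \<Sum>b<k. P (i, a) (j, b) + p (i, a) * p (j, b))"
    unfolding corr_def cov_def
  proof (intro sum_mono)
    fix a b assume "a \<in> {..<k}" "b \<in> {..<k}"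
    hence "0 \<le> P (i, a) (j, b)" "0 \<le> p (i, a) * p (j, b)"
      using assms P_nonneg p_nonneg by auto
    thus "\<bar>P (i, a) (j, b) - p (i, a) * p (j, b)\<bar> \<le> P (i, a) (j, b) + p (i, a) * p (j, b)"
      by linarith
  qed
  also have "\<dots> = 2"
    using assms by (simp add: sum.distrib P_marginal p_total sum_distrib_left[symmetric])
  finally show ?thesis .
qed

text \<open>Expanding the square, the cross term and the last term combine through the marginals.
  The remaining double sum is the expected collision probability of \<open>X_i\<close> once
  \<open>X_j\<close> is revealed.\<close>

lemma gain_eq:
  assumes "i < n" "j < n"
  shows "gain i j = (\<Sum>a<k. \<Sum>b<k. (P (i, a) (j, b))\<^sup>2 / p (j, b)) - (\<Sum>a<k. (p (i, a))\<^sup>2)"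
proof -
  have "(\<Sum>b<k. (cov (i, a) (j, b))\<^sup>2 / p (j, b))
      = (\<Sum>b<k. (P (i, a) (j, b))\<^sup>2 / p (j, b)) - (p (i, a))\<^sup>2" if a: "a < k" for a
  proof -
    have "(\<Sum>b<k. (cov (i, a) (j, b))\<^sup>2 / p (j, b))
        = (\<Sum>b<k. (P (i, a) (j, b))\<^sup>2 / p (j, b) - 2 * p (i, a) * P (i, a) (j, b)
            + (p (i, a))\<^sup>2 * p (j, b))"
    proof (intro sum.cong refl)
      fix b assume "b \<in> {..<k}"
      hence b: "b < k" by simp
      show "(cov (i, a) (j, b))\<^sup>2 / p (j, b) = (P (i, a) (j, b))\<^sup>2 / p (j, b)
          - 2 * p (i, a) * P (i, a) (j, b) + (p (i, a))\<^sup>2 * p (j, b)"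
        using P_eq_0[OF assms a b]
        by (cases "p (j, b) = 0") (simp_all add: cov_def field_simps power2_eq_square)
    qed
    also have "\<dots> = (\<Sum>b<k. (P (i, a) (j, b))\<^sup>2 / p (j, b)) - 2 * p (i, a) * (\<Sum>b<k. P (i, a) (j, b))
        + (p (i, a))\<^sup>2 * (\<Sum>b<k. p (j, b))"
      by (simp add: sum.distrib sum_subtractf sum_distrib_left)
    also have "\<dots> = (\<Sum>b<k. (P (i, a) (j, b))\<^sup>2 / p (j, b)) - (p (i, a))\<^sup>2"
      using assms a by (simp add: P_marginal p_total power2_eq_square)
    finally show ?thesis .
  qed
  thus ?thesis by (simp add: gain_def sum_subtractf)
qed

text \<open>A joint probability is at most \<open>p (j, b)\<close>, so each quotient in
  \<open>gain_eq\<close> is at most the joint probability itself.\<close>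

lemma gain_le_1:
  assumes "i < n" "j < n"
  shows "gain i j \<le> 1"
proof -
  have "gain i j \<le> (\<Sum>a<k. \<Sum>b<k. (P (i, a) (j, b))\<^sup>2 / p (j, b))"
    using gain_eq[OF assms] by (simp add: sum_nonneg)
  also have "\<dots> \<le> (\<Sum>a<k. \<Sum>b<k. P (i, a) (j, b))"
  proof (intro sum_mono)
    fix a b assume "a \<in> {..<k}" "b \<in> {..<k}"
    hence ab: "a < k" "b < k" by auto
    have "P (i, a) (j, b) * P (i, a) (j, b) \<le> P (i, a) (j, b) * p (j, b)"
      using P_nonneg P_le_right assms ab by (intro mult_left_mono) auto
    thus "(P (i, a) (j, b))\<^sup>2 / p (j, b) \<le> P (i, a) (j, b)"
      using p_nonneg[OF assms(2) ab(2)] P_eq_0[OF assms ab]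
      by (cases "p (j, b) = 0") (auto simp: power2_eq_square divide_le_eq)
  qed
  also have "\<dots> = 1" using assms by (simp add: P_marginal p_total)
  finally show ?thesis .
qed

lemma kernel_nonneg: "i < n \<Longrightarrow> j < n \<Longrightarrow> 0 \<le> kernel i j"
  unfolding kernel_def using p_nonneg by (intro sum_nonneg divide_nonneg_nonneg) auto

lemma kernel_sym:
  assumes "i < n" "j < n"
  shows "kernel i j = kernel j i"
proof -
  have "kernel i j = (\<Sum>b<k. \<Sum>a<k. (cov (i, a) (j, b))\<^sup>2 / sqrt (p (i, a) * p (j, b)))"
    unfolding kernel_def by (rule sum.swap)
  also have "\<dots> = kernel j i"
    unfolding kernel_def using assms by (intro sum.cong refl) (simp add: cov_sym mult.commute)
  finally show ?thesis .
qed

text \<open>The geometric mean of \<open>1 / p (i, a)\<close> and \<open>1 / p (j, b)\<close> is at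
  most their arithmetic mean, which yields the gains in both directions.\<close>

lemma kernel_le_gain:
  assumes "i < n" "j < n"
  shows "kernel i j \<le> (gain i j + gain j i) / 2"
proof -
  have gain': "gain j i = (\<Sum>a<k. \<Sum>b<k. (cov (i, a) (j, b))\<^sup>2 / p (i, a))"
    unfolding gain_def using assms cov_sym by (subst sum.swap) (auto intro!: sum.cong)
  have "kernel i j \<le> (\<Sum>a<k. \<Sum>b<k. ((cov (i, a) (j, b))\<^sup>2 / p (j, b) + (cov (i, a) (j, b))\<^sup>2 / p (i, a)) / 2)"
    unfolding kernel_def
  proof (intro sum_mono)
    fix a b assume "a \<in> {..<k}" "b \<in> {..<k}"
    hence ab: "a < k" "b < k" by auto
    let ?c = "(cov (i, a) (j, b))\<^sup>2" and ?x = "p (i, a)" and ?y = "p (j, b)"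
    show "?c / sqrt (?x * ?y) \<le> (?c / ?y + ?c / ?x) / 2"
    proof (cases "?x = 0 \<or> ?y = 0")
      case True
      thus ?thesis using cov_eq_0[OF assms ab] by simp
    next
      case False
      hence pos: "?x > 0" "?y > 0" using p_nonneg assms ab by (simp_all add: order_less_le)
      have "1 / sqrt (?x * ?y) = sqrt ((1 / ?y) * (1 / ?x))"
        using pos by (simp add: real_sqrt_divide real_sqrt_mult)
      also have "\<dots> \<le> (1 / ?y + 1 / ?x) / 2" using pos by (intro arith_geo_mean_sqrt) auto
      finally have "?c * (1 / sqrt (?x * ?y)) \<le> ?c * ((1 / ?y + 1 / ?x) / 2)"
        by (intro mult_left_mono) auto
      thus ?thesis by (simp add: algebra_simps)
    qed
  qed
  also have "\<dots> = (gain i j + gain j i) / 2"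
    unfolding gain' by (simp add: gain_def sum.distrib sum_divide_distrib[symmetric])
  finally show ?thesis .
qed

text \<open>Cauchy-Schwarz in a linearised form that can be averaged over edges: the weights
  \<open>sqrt (p (i, a) * p (j, b))\<close> sum to at most \<open>k\<close>, which is where the
  factor \<open>k\<close> comes from.\<close>

lemma corr_le_kernel:
  assumes "i < n" "j < n" "0 < k" "\<epsilon> > 0"
  shows "corr i j \<le> \<epsilon> / 4 + real k / \<epsilon> * kernel i j"
proof -
  have "corr i j \<le> (\<Sum>a<k. \<Sum>b<k. \<epsilon> / (4 * real k) * ((p (i, a) + p (j, b)) / 2)
      + real k / \<epsilon> * ((cov (i, a) (j, b))\<^sup>2 / sqrt (p (i, a) * p (j, b))))"
    unfolding corr_def
  proof (intro sum_mono)
    fix a b assume "a \<in> {..<k}" "b \<in> {..<k}"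
    hence ab: "a < k" "b < k" by auto
    define c s where "c = \<bar>cov (i, a) (j, b)\<bar>" and "s = sqrt (p (i, a) * p (j, b))"
    have nn: "0 \<le> p (i, a)" "0 \<le> p (j, b)" using p_nonneg assms ab by auto
    have s_le: "s \<le> (p (i, a) + p (j, b)) / 2" unfolding s_def using nn by (intro arith_geo_mean_sqrt)
    have "c \<le> \<epsilon> / (4 * real k) * s + real k / \<epsilon> * (c\<^sup>2 / s)"
    proof (cases "s = 0")
      case True
      hence "c = 0" using cov_eq_0[OF assms(1,2) ab] by (auto simp: s_def c_def)
      thus ?thesis using True by simp
    next
      case False
      hence s: "s > 0" using nn by (simp add: s_def order_less_le)
      \<comment> \<open>AM-GM: the two summands have product \<open>c\<^sup>2 / 4\<close>, so their
        sum is at least \<open>c\<close>.\<close>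
      have "0 \<le> (\<epsilon> * s - 2 * real k * c)\<^sup>2 / (4 * real k * \<epsilon> * s)"
        using s assms by simp
      also have "\<dots> = \<epsilon> / (4 * real k) * s + real k / \<epsilon> * (c\<^sup>2 / s) - c"
        using s assms by (simp add: field_simps power2_eq_square)
      finally show ?thesis by simp
    qed
    also have "\<dots> \<le> \<epsilon> / (4 * real k) * ((p (i, a) + p (j, b)) / 2) + real k / \<epsilon> * (c\<^sup>2 / s)"
      using s_le assms by (intro add_right_mono mult_left_mono) auto
    finally show "\<bar>cov (i, a) (j, b)\<bar> \<le> \<epsilon> / (4 * real k) * ((p (i, a) + p (j, b)) / 2)
      + real k / \<epsilon> * ((cov (i, a) (j, b))\<^sup>2 / sqrt (p (i, a) * p (j, b)))"
      by (simp add: c_def s_def)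
  qed
  also have "\<dots> = \<epsilon> / (4 * real k) * (\<Sum>a<k. \<Sum>b<k. (p (i, a) + p (j, b)) / 2) + real k / \<epsilon> * kernel i j"
    unfolding kernel_def sum.distrib sum_distrib_left ..
  also have "(\<Sum>a<k. \<Sum>b<k. (p (i, a) + p (j, b)) / 2) = real k"
    using assms(1,2) by (simp add: sum_divide_distrib[symmetric] sum.distrib sum_distrib_left[symmetric] p_total)
  finally show ?thesis using assms(3) by simp
qed

text \<open>The denominators are absorbed into the test vector, and what remains is the entrywise
  square of a positive semidefinite matrix.\<close>

lemma kernel_psd:
  assumes "pos_semidef_on ({..<n} \<times> {..<k}) cov"
  shows "0 \<le> (\<Sum>i<n. \<Sum>j<n. kernel i j * (z i * z j))"
proof -
  define w where "w x = z (fst x) / sqrt (p x)" for x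
  have "(\<Sum>i<n. \<Sum>j<n. kernel i j * (z i * z j))
      = (\<Sum>i<n. \<Sum>j<n. \<Sum>a<k. \<Sum>b<k. w (i, a) * (cov (i, a) (j, b))\<^sup>2 * w (j, b))"
    unfolding kernel_def sum_distrib_right
    by (intro sum.cong refl) (simp add: w_def real_sqrt_mult)
  also have "\<dots> = (\<Sum>i<n. \<Sum>a<k. \<Sum>j<n. \<Sum>b<k. w (i, a) * (cov (i, a) (j, b))\<^sup>2 * w (j, b))"
    by (rule sum.cong[OF refl], rule sum.swap)
  also have "\<dots> = (\<Sum>x\<in>{..<n} \<times> {..<k}. \<Sum>y\<in>{..<n} \<times> {..<k}. w x * (cov x y)\<^sup>2 * w y)"
    by (simp only: sum.cartesian_product')
  also have "\<dots> \<ge> 0" using assms by (intro schur_product_square_nonneg) auto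
  finally show ?thesis .
qed

text \<open>Edges between good vertices are handled by the truncated kernel and the spectrum of
  \<open>G\<close>; edges touching a bad vertex by \<open>corr i j \<le> 2\<close> and a bound on
  the number of bad vertices.\<close>

theorem edge_expectation_corr_le:
  assumes G: "regular_graph n G" and psd: "pos_semidef_on ({..<n} \<times> {..<k}) cov"
    and pos: "0 < n" "0 < k" "\<epsilon> > 0" "H > 0" "\<tau> \<ge> 0"
  shows "edge_expectation n G corr \<le> \<epsilon> / 4 + real k / \<epsilon> * (\<tau> + real (threshold_rank \<tau> G) * H)
    + 4 / H * ((\<Sum>i<n. \<Sum>j<n. gain i j) / (real n)\<^sup>2)"
proof -
  define R where "R = real (threshold_rank \<tau> G)"
  define bad where "bad i \<longleftrightarrow> (\<Sum>j<n. kernel i j) > real n * H" for i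
  define K where "K i j = (if bad i \<or> bad j then 0 else kernel i j)" for i j
  have G_nonneg: "0 \<le> G $$ (i, j)" and G_sym: "G $$ (i, j) = G $$ (j, i)"
    if "i < n" "j < n" for i j using G that by (auto simp: regular_graph_def)
  have G_row: "(\<Sum>j<n. G $$ (i, j)) = 1" if "i < n" for i using G that by (auto simp: regular_graph_def)
  have K_sym: "K i j = K j i" if "i < n" "j < n" for i j
    using kernel_sym[OF that] by (simp add: K_def disj_commute)
  have K_nonneg: "0 \<le> K i j" if "i < n" "j < n" for i j
    using kernel_nonneg[OF that] by (simp add: K_def)
  have K_row: "(\<Sum>j<n. K i j) \<le> real n * H" if "i < n" for i
  proof (cases "bad i")
    case True
    thus ?thesis using pos by (simp add: K_def)
  next
    case False
    have "(\<Sum>j<n. K i j) \<le> (\<Sum>j<n. kernel i j)"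
      using kernel_nonneg that by (intro sum_mono) (auto simp: K_def)
    thus ?thesis using False by (simp add: bad_def)
  qed
  have K_psd: "0 \<le> (\<Sum>i<n. \<Sum>j<n. K i j * (z i * z j))" for z
  proof -
    \<comment> \<open>Testing \<open>K\<close> with \<open>z\<close> is testing
      \<open>kernel\<close> with \<open>z\<close> set to \<open>0\<close> at the bad
      vertices.\<close>
    have "(\<Sum>i<n. \<Sum>j<n. K i j * (z i * z j))
        = (\<Sum>i<n. \<Sum>j<n. kernel i j * ((if bad i then 0 else z i) * (if bad j then 0 else z j)))"
      by (intro sum.cong refl) (simp add: K_def)
    thus ?thesis using kernel_psd[OF psd, of "\<lambda>i. if bad i then 0 else z i"] by simp
  qed
  have K_diag: "(\<Sum>i<n. K i i) \<le> real n"
  proof -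
    have "K i i \<le> 1" if "i < n" for i
      using kernel_le_gain[OF that that] gain_le_1[OF that that] by (simp add: K_def)
    hence "(\<Sum>i<n. K i i) \<le> (\<Sum>i<n. 1)" by (intro sum_mono) auto
    thus ?thesis by simp
  qed
  have GK: "(\<Sum>i<n. \<Sum>j<n. G $$ (i, j) * K i j) \<le> \<tau> * real n + R * (real n * H)"
  proof -
    have "(\<Sum>i<n. \<Sum>j<n. G $$ (i, j) * K i j) \<le> \<tau> * (\<Sum>i<n. K i i) + R * (real n * H)"
      unfolding R_def using graph_inner_product_le[OF G \<open>\<tau> \<ge> 0\<close>, of K] K_sym K_nonneg K_row K_psd
      by blast
    thus ?thesis using mult_left_mono[OF K_diag \<open>\<tau> \<ge> 0\<close>] by linarith
  qed
  \<comment> \<open>Markov's inequality: each bad row carries kernel mass above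
    \<open>n * H\<close>, while the total kernel mass is at most the total gain.\<close>
  have bads: "(\<Sum>i<n. of_bool (bad i)) * (real n * H) \<le> (\<Sum>i<n. \<Sum>j<n. gain i j)"
  proof -
    have "(\<Sum>i<n. of_bool (bad i)) * (real n * H) = (\<Sum>i<n. of_bool (bad i) * (real n * H))"
      by (simp add: sum_distrib_right)
    also have "\<dots> \<le> (\<Sum>i<n. \<Sum>j<n. kernel i j)"
      using kernel_nonneg by (intro sum_mono) (auto simp: bad_def of_bool_def intro!: sum_nonneg)
    also have "\<dots> \<le> (\<Sum>i<n. \<Sum>j<n. (gain i j + gain j i) / 2)"
      using kernel_le_gain by (intro sum_mono) auto
    also have "\<dots> = ((\<Sum>i<n. \<Sum>j<n. gain i j) + (\<Sum>i<n. \<Sum>j<n. gain j i)) / 2"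
      by (simp add: sum.distrib sum_divide_distrib[symmetric])
    also have "(\<Sum>i<n. \<Sum>j<n. gain j i) = (\<Sum>i<n. \<Sum>j<n. gain i j)" by (rule sum.swap)
    finally show ?thesis by simp
  qed
  \<comment> \<open>A bad vertex is charged \<open>2\<close> in either endpoint position, whence the
    factor \<open>4\<close> below. The last term uses \<open>G $$ (j, i)\<close> so that summing
    over \<open>i\<close> gives a row sum.\<close>
  have "(\<Sum>i<n. \<Sum>j<n. G $$ (i, j) * corr i j)
      \<le> (\<Sum>i<n. \<Sum>j<n. G $$ (i, j) * (\<epsilon> / 4) + real k / \<epsilon> * (G $$ (i, j) * K i j)
          + (2 * of_bool (bad i)) * G $$ (i, j) + (2 * of_bool (bad j)) * G $$ (j, i))"
  proof (intro sum_mono)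
    fix i j assume "i \<in> {..<n}" "j \<in> {..<n}"
    hence ij: "i < n" "j < n" by auto
    have "corr i j \<le> \<epsilon> / 4 + real k / \<epsilon> * K i j + 2 * of_bool (bad i) + 2 * of_bool (bad j)"
      using corr_le_kernel[OF ij pos(2,3)] corr_le_2[OF ij] \<open>\<epsilon> > 0\<close> by (auto simp: K_def)
    hence "G $$ (i, j) * corr i j
        \<le> G $$ (i, j) * (\<epsilon> / 4 + real k / \<epsilon> * K i j + 2 * of_bool (bad i) + 2 * of_bool (bad j))"
      using G_nonneg[OF ij] by (rule mult_left_mono)
    thus "G $$ (i, j) * corr i j \<le> G $$ (i, j) * (\<epsilon> / 4) + real k / \<epsilon> * (G $$ (i, j) * K i j)
          + (2 * of_bool (bad i)) * G $$ (i, j) + (2 * of_bool (bad j)) * G $$ (j, i)"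
      using G_sym[OF ij] by (simp add: algebra_simps)
  qed
  also have "\<dots> = (\<Sum>i<n. \<Sum>j<n. G $$ (i, j)) * (\<epsilon> / 4) + real k / \<epsilon> * (\<Sum>i<n. \<Sum>j<n. G $$ (i, j) * K i j)
      + (\<Sum>i<n. (2 * of_bool (bad i)) * (\<Sum>j<n. G $$ (i, j)))
      + (\<Sum>i<n. \<Sum>j<n. (2 * of_bool (bad j)) * G $$ (j, i))"
    by (simp only: sum.distrib sum_distrib_left sum_distrib_right)
  also have "(\<Sum>i<n. \<Sum>j<n. (2 * of_bool (bad j)) * G $$ (j, i))
      = (\<Sum>j<n. (2 * of_bool (bad j)) * (\<Sum>i<n. G $$ (j, i)))"
    by (subst sum.swap) (simp add: sum_distrib_left)
  also have "(\<Sum>i<n. (2 * of_bool (bad i)) * (\<Sum>j<n. G $$ (i, j))) = 2 * (\<Sum>i<n. of_bool (bad i))"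
    by (simp add: G_row sum_distrib_left)
  also have "(\<Sum>i<n. \<Sum>j<n. G $$ (i, j)) = real n" by (simp add: G_row)
  finally have "(\<Sum>i<n. \<Sum>j<n. G $$ (i, j) * corr i j)
      \<le> real n * (\<epsilon> / 4) + real k / \<epsilon> * (\<Sum>i<n. \<Sum>j<n. G $$ (i, j) * K i j) + 4 * (\<Sum>i<n. of_bool (bad i))"
    by simp
  also have "\<dots> \<le> real n * (\<epsilon> / 4) + real k / \<epsilon> * (\<tau> * real n + R * (real n * H))
      + 4 * ((\<Sum>i<n. \<Sum>j<n. gain i j) / (real n * H))"
  proof -
    have "(\<Sum>i<n. of_bool (bad i)) \<le> (\<Sum>i<n. \<Sum>j<n. gain i j) / (real n * H)"
      using bads pos by (simp add: le_divide_eq)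
    moreover have "real k / \<epsilon> * (\<Sum>i<n. \<Sum>j<n. G $$ (i, j) * K i j)
        \<le> real k / \<epsilon> * (\<tau> * real n + R * (real n * H))"
      using GK \<open>\<epsilon> > 0\<close> by (intro mult_left_mono) auto
    ultimately show ?thesis by linarith
  qed
  finally have "(\<Sum>i<n. \<Sum>j<n. G $$ (i, j) * corr i j) / real n
      \<le> (real n * (\<epsilon> / 4) + real k / \<epsilon> * (\<tau> * real n + R * (real n * H))
      + 4 * ((\<Sum>i<n. \<Sum>j<n. gain i j) / (real n * H))) / real n"
    by (rule divide_right_mono) simp
  also have "\<dots> = \<epsilon> / 4 + real k / \<epsilon> * (\<tau> + R * H) + 4 / H * ((\<Sum>i<n. \<Sum>j<n. gain i j) / (real n)\<^sup>2)"
    using pos by (simp add: field_simps power2_eq_square)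
  finally show ?thesis
    by (simp add: edge_expectation_def R_def sum_distrib_left[symmetric] sum_divide_distrib[symmetric])
qed

end

section \<open>Conditioning local random variables\<close>

lemma measure_cond_pmf:
  assumes "set_pmf p \<inter> s \<noteq> {}"
  shows "measure_pmf.prob (cond_pmf p s) A = measure_pmf.prob p (s \<inter> A) / measure_pmf.prob p s"
  unfolding cond_pmf.rep_eq[OF assms]
  by (rule measure_uniform_measure)
    (use assms in \<open>auto simp: emeasure_measure_pmf_not_zero\<close>)

lemma expectation_bind_pmf_finite:
  fixes h :: "'b \<Rightarrow> real"
  assumes "finite (set_pmf p)" "\<And>x. x \<in> set_pmf p \<Longrightarrow> finite (set_pmf (f x))"
  shows "measure_pmf.expectation (bind_pmf p f) h
    = measure_pmf.expectation p (\<lambda>x. measure_pmf.expectation (f x) h)"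
  using assms
  by (subst pmf_expectation_bind[where A = "set_pmf p"])
    (auto simp: integral_measure_pmf[where A = "set_pmf p"])

lemma expectation_cong_set_pmf:
  fixes f :: "'a \<Rightarrow> real"
  assumes "\<And>x. x \<in> set_pmf p \<Longrightarrow> f x = g x"
  shows "measure_pmf.expectation p f = measure_pmf.expectation p g"
  using assms by (intro integral_cong_AE) (auto simp: AE_measure_pmf_iff)

lemma expectation_mono_set_pmf:
  fixes f :: "'a \<Rightarrow> real"
  assumes "finite (set_pmf p)" "\<And>x. x \<in> set_pmf p \<Longrightarrow> f x \<le> g x"
  shows "measure_pmf.expectation p f \<le> measure_pmf.expectation p g"
  using assms by (intro integral_mono_AE integrable_measure_pmf_finite) (auto simp: AE_measure_pmf_iff)

lemma sum_prob_fibres: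
  fixes q :: "'a pmf" and f :: "'a \<Rightarrow> nat"
  assumes "\<And>x. x \<in> set_pmf q \<Longrightarrow> f x < k"
  shows "(\<Sum>b<k. measure_pmf.prob q {x. Q x \<and> f x = b}) = measure_pmf.prob q {x. Q x}"
proof -
  have "(\<Sum>b<k. measure_pmf.prob q {x. Q x \<and> f x = b}) = measure_pmf.prob q (\<Union>b<k. {x. Q x \<and> f x = b})"
    by (rule measure_pmf.finite_measure_finite_Union[symmetric]) (auto simp: disjoint_family_on_def)
  also have "\<dots> = measure_pmf.prob q {x. Q x}"
    using assms by (intro measure_pmf.finite_measure_eq_AE) (auto simp: AE_measure_pmf_iff)
  finally show ?thesis .
qed

lemma covariance_eq:
  assumes "finite (set_pmf q)"
  shows "covariance q f g = measure_pmf.expectation q (\<lambda>x. f x * g x)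
    - measure_pmf.expectation q f * measure_pmf.expectation q g"
proof -
  have [simp]: "integrable (measure_pmf q) h" for h :: "'a \<Rightarrow> real"
    using assms by (rule integrable_measure_pmf_finite)
  show ?thesis by (simp add: covariance_def algebra_simps)
qed

lemma expectation_of_bool: "measure_pmf.expectation q (\<lambda>x. of_bool (Q x)) = measure_pmf.prob q {x. Q x}"
proof -
  have "(\<lambda>x. of_bool (Q x) :: real) = indicator {x. Q x}" by (auto simp: indicator_def)
  thus ?thesis by simp
qed

locale local_random_variables =
  fixes n k r :: nat and \<mu> :: "nat set \<Rightarrow> (nat \<Rightarrow> nat) pmf"
  assumes local_rvs: "local_rvs n k r \<mu>"
begin

lemma set_local: "T \<subseteq> {..<n} \<Longrightarrow> card T \<le> r + 2 \<Longrightarrow> set_pmf (\<mu> T) \<subseteq> T \<rightarrow>\<^sub>E {..<k}"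
  using local_rvs unfolding local_rvs_def by blast

lemma finite_set_local:
  assumes "T \<subseteq> {..<n}" "card T \<le> r + 2"
  shows "finite (set_pmf (\<mu> T))"
  by (rule finite_subset[OF set_local[OF assms] finite_PiE])
    (use assms finite_subset in auto)

text \<open>Take \<open>W\<close> as the second set of the consistency condition; samples of
  \<open>\<mu> W\<close> are extensional, so restricting them to \<open>W\<close> changes
  nothing.\<close>

lemma local_marginal:
  assumes "T \<subseteq> {..<n}" "card T \<le> r + 2" "W \<subseteq> T"
  shows "map_pmf (\<lambda>x. restrict x W) (\<mu> T) = \<mu> W"
proof -
  have "finite T" using assms(1) finite_subset by blast
  hence W: "W \<subseteq> {..<n}" "card W \<le> r + 2"
    using assms card_mono[of T W] by auto
  have TW: "T \<inter> W = W" using assms(3) by blast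
  have "map_pmf (\<lambda>x. restrict x (T \<inter> W)) (\<mu> T) = map_pmf (\<lambda>x. restrict x (T \<inter> W)) (\<mu> W)"
    using local_rvs assms W unfolding local_rvs_def by blast
  also have "\<dots> = map_pmf (\<lambda>x. x) (\<mu> W)"
    unfolding TW
  proof (intro map_pmf_cong refl)
    fix x assume "x \<in> set_pmf (\<mu> W)"
    hence "x \<in> extensional W" using set_local[OF W] by (auto simp: PiE_def)
    thus "restrict x W = x" by (rule extensional_restrict)
  qed
  finally show ?thesis by (simp add: TW)
qed

lemma card_union_pair:
  assumes "card S \<le> r"
  shows "card (S \<union> {i, j}) \<le> r + 2"
proof -
  have "card (S \<union> {i, j}) \<le> card S + card {i, j}" by (rule card_Un_le)
  also have "card {i, j} \<le> 2" by (simp add: card_insert_if)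
  finally show ?thesis using assms by simp
qed

text \<open>Collects the conditions under which \<open>cond_local \<mu> S y T\<close> is a genuine
  conditioning: enough locality and a seed assignment of positive probability.\<close>

definition valid :: "nat set \<Rightarrow> (nat \<Rightarrow> nat) \<Rightarrow> nat set \<Rightarrow> bool" where
  "valid S y T \<longleftrightarrow> S \<subseteq> {..<n} \<and> T \<subseteq> {..<n} \<and> card (S \<union> T) \<le> r + 2 \<and> y \<in> set_pmf (\<mu> S)"

lemma valid_pair:
  "S \<subseteq> {..<n} \<Longrightarrow> card S \<le> r \<Longrightarrow> y \<in> set_pmf (\<mu> S) \<Longrightarrow> i < n \<Longrightarrow> j < n \<Longrightarrow> valid S y {i, j}"
  using card_union_pair by (auto simp: valid_def)

lemma valid_single:
  "S \<subseteq> {..<n} \<Longrightarrow> card S \<le> r \<Longrightarrow> y \<in> set_pmf (\<mu> S) \<Longrightarrow> i < n \<Longrightarrow> valid S y {i}"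
  using valid_pair[of S y i i] by simp

text \<open>\<open>cond_pmf\<close> is specified only for events that meet the support; by
  consistency \<open>y\<close> extends to a sample of \<open>\<mu> (S \<union> T)\<close>.\<close>

lemma cond_nonempty:
  assumes "valid S y T"
  shows "set_pmf (\<mu> (S \<union> T)) \<inter> {x. restrict x S = y} \<noteq> {}"
proof -
  have "y \<in> set_pmf (map_pmf (\<lambda>x. restrict x S) (\<mu> (S \<union> T)))"
    using assms by (subst local_marginal) (auto simp: valid_def)
  thus ?thesis by auto
qed

lemma set_cond_local:
  assumes "valid S y T" "x \<in> set_pmf (cond_local \<mu> S y T)"
  shows "x \<in> (S \<union> T) \<rightarrow>\<^sub>E {..<k}" "restrict x S = y" "x \<in> set_pmf (\<mu> (S \<union> T))"
proof -
  have "x \<in> set_pmf (\<mu> (S \<union> T)) \<inter> {x. restrict x S = y}"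
    using assms(2) set_cond_pmf[OF cond_nonempty[OF assms(1)]] by (simp add: cond_local_def)
  thus "x \<in> (S \<union> T) \<rightarrow>\<^sub>E {..<k}" "restrict x S = y" "x \<in> set_pmf (\<mu> (S \<union> T))"
    using set_local[of "S \<union> T"] assms(1) by (auto simp: valid_def)
qed

lemma finite_set_cond_local:
  assumes "valid S y T"
  shows "finite (set_pmf (cond_local \<mu> S y T))"
proof (rule finite_subset)
  show "set_pmf (cond_local \<mu> S y T) \<subseteq> set_pmf (\<mu> (S \<union> T))" using set_cond_local(3)[OF assms] by blast
  show "finite (set_pmf (\<mu> (S \<union> T)))" using assms by (intro finite_set_local) (auto simp: valid_def)
qed

text \<open>Conditioning commutes with marginalisation because the conditioning event depends only
  on the coordinates in \<open>S\<close>.\<close>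

lemma cond_local_marginal:
  assumes "valid S y T" "T' \<subseteq> T"
  shows "map_pmf (\<lambda>x. restrict x (S \<union> T')) (cond_local \<mu> S y T) = cond_local \<mu> S y T'"
proof -
  have vimage: "(\<lambda>x. restrict x (S \<union> T')) -` {x. restrict x S = y} = {x. restrict x S = y}"
    by (auto simp: Int_absorb1)
  have "cond_local \<mu> S y T' = cond_pmf (map_pmf (\<lambda>x. restrict x (S \<union> T')) (\<mu> (S \<union> T))) {x. restrict x S = y}"
    unfolding cond_local_def using assms by (subst local_marginal) (auto simp: valid_def)
  also have "\<dots> = map_pmf (\<lambda>x. restrict x (S \<union> T')) (cond_local \<mu> S y T)"
    unfolding cond_local_def using cond_nonempty[OF assms(1)] by (subst cond_map_pmf) (simp_all add: vimage)
  finally show ?thesis ..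
qed

lemma map_cond_local_mono:
  assumes "valid S y T" "i \<in> T"
  shows "map_pmf (\<lambda>x. x i) (cond_local \<mu> S y {i}) = map_pmf (\<lambda>x. x i) (cond_local \<mu> S y T)"
  using assms by (subst cond_local_marginal[of S y T "{i}", symmetric]) (auto simp: pmf.map_comp o_def)

text \<open>The law of total probability; it recombines averages over seed assignments into local
  distributions.\<close>

lemma bind_cond_local:
  assumes "S \<subseteq> {..<n}" "T \<subseteq> {..<n}" "card (S \<union> T) \<le> r + 2"
  shows "bind_pmf (\<mu> S) (\<lambda>y. cond_local \<mu> S y T) = \<mu> (S \<union> T)"
proof -
  have v: "valid S y T" if "y \<in> set_pmf (\<mu> S)" for y using assms that by (simp add: valid_def)
  have S: "\<mu> S = map_pmf (\<lambda>x. restrict x S) (\<mu> (S \<union> T))"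
    using assms by (subst local_marginal) auto
  have "bind_pmf (\<mu> S) (\<lambda>y. cond_pmf (\<mu> (S \<union> T)) {x. restrict x S = y}) = \<mu> (S \<union> T)"
  proof (rule bind_cond_pmf_cancel)
    fix y assume "y \<in> set_pmf (\<mu> S)"
    thus "set_pmf (\<mu> (S \<union> T)) \<inter> {x. restrict x S = y} \<noteq> {}" using cond_nonempty v by blast
  next
    fix x assume "x \<in> set_pmf (\<mu> (S \<union> T))"
    thus "set_pmf (\<mu> S) \<inter> {y. restrict x S = y} \<noteq> {}" by (subst S) auto
  next
    fix x y :: "nat \<Rightarrow> nat" assume "restrict x S = y"
    thus "measure_pmf.prob (\<mu> (S \<union> T)) {x. restrict x S = y} = measure_pmf.prob (\<mu> S) {y'. restrict x S = y'}"
      by (subst S) (auto simp: vimage_def intro: arg_cong[where f = "measure_pmf.prob (\<mu> (S \<union> T))"])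
  qed
  thus ?thesis by (simp add: cond_local_def)
qed

section \<open>Conditional probabilities and the chain rule\<close>

definition cprob :: "nat set \<Rightarrow> (nat \<Rightarrow> nat) \<Rightarrow> nat \<times> nat \<Rightarrow> real" where
  "cprob S y = (\<lambda>(i, a). measure_pmf.prob (cond_local \<mu> S y {i}) {x. x i = a})"

definition cjoint :: "nat set \<Rightarrow> (nat \<Rightarrow> nat) \<Rightarrow> nat \<times> nat \<Rightarrow> nat \<times> nat \<Rightarrow> real" where
  "cjoint S y = (\<lambda>(i, a) (j, b). measure_pmf.prob (cond_local \<mu> S y {i, j}) {x. x i = a \<and> x j = b})"

lemma pmf_map_coordinate: "pmf (map_pmf (\<lambda>x. x i) q) a = measure_pmf.prob q {x. x i = a}"
  by (simp add: pmf_map vimage_def)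

lemma cprob_eq:
  assumes "valid S y T" "i \<in> T"
  shows "cprob S y (i, a) = measure_pmf.prob (cond_local \<mu> S y T) {x. x i = a}"
  using map_cond_local_mono[OF assms] by (simp add: cprob_def pmf_map_coordinate[symmetric])

lemma pairwise_marginals_cond:
  assumes S: "S \<subseteq> {..<n}" "card S \<le> r" "y \<in> set_pmf (\<mu> S)"
  shows "pairwise_marginals n k (cjoint S y) (cprob S y)"
proof
  fix i j a b
  show "0 \<le> cjoint S y (i, a) (j, b)" by (simp add: cjoint_def)
  show "cjoint S y (i, a) (j, b) = cjoint S y (j, b) (i, a)"
    by (simp add: cjoint_def insert_commute conj_commute)
next
  fix i j a assume ij: "i < n" "j < n"
  have "x j < k" if "x \<in> set_pmf (cond_local \<mu> S y {i, j})" for x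
    using set_cond_local(1)[OF valid_pair[OF S ij] that] by auto
  thus "(\<Sum>b<k. cjoint S y (i, a) (j, b)) = cprob S y (i, a)"
    using cprob_eq[OF valid_pair[OF S ij], of i a]
    by (simp add: cjoint_def sum_prob_fibres)
next
  fix i assume i: "i < n"
  have "x i < k" if "x \<in> set_pmf (cond_local \<mu> S y {i})" for x
    using set_cond_local(1)[OF valid_single[OF S i] that] by auto
  thus "(\<Sum>a<k. cprob S y (i, a)) = 1"
    using sum_prob_fibres[of "cond_local \<mu> S y {i}" "\<lambda>x. x i" k "\<lambda>_. True"] by (simp add: cprob_def)
qed

text \<open>Identifies the matrix that is assumed positive semidefinite with \<open>cov\<close> of
  the locale \<open>pairwise_marginals\<close>.\<close>

lemma cond_cov_matrix_eq:
  assumes S: "S \<subseteq> {..<n}" "card S \<le> r" "y \<in> set_pmf (\<mu> S)" and ij: "i < n" "j < n"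
  shows "cond_cov_matrix \<mu> S y (i, a) (j, b) = cjoint S y (i, a) (j, b) - cprob S y (i, a) * cprob S y (j, b)"
proof -
  note v = valid_pair[OF S ij]
  show ?thesis
    unfolding cond_cov_matrix_def prod.case
    by (simp add: covariance_eq[OF finite_set_cond_local[OF v]] of_bool_conj[symmetric] expectation_of_bool
        cprob_eq[OF v] cjoint_def del: of_bool_conj)
qed

text \<open>The chain rule for conditional probabilities. It covers \<open>j \<in> S\<close> as
  well: there \<open>nz\<close> forces \<open>y j = b\<close>, so the update changes
  nothing.\<close>

lemma cprob_insert:
  assumes S: "S \<subseteq> {..<n}" "card S \<le> r" "y \<in> set_pmf (\<mu> S)" and ij: "i < n" "j < n"
    and nz: "cprob S y (j, b) \<noteq> 0"
  shows "cprob (insert j S) (y(j := b)) (i, a) = cjoint S y (i, a) (j, b) / cprob S y (j, b)"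
proof -
  note v = valid_pair[OF S ij]
  let ?U = "S \<union> {i, j}" and ?Y = "{x. restrict x S = y}" and ?B = "{x :: nat \<Rightarrow> nat. x j = b}" and ?A = "{x :: nat \<Rightarrow> nat. x i = a}"
  have ext: "y \<in> extensional S" using S set_local[of S] by (auto simp: PiE_def)
  have "set_pmf (cond_local \<mu> S y {i, j}) \<inter> ?B \<noteq> {}"
    using nz unfolding cprob_eq[OF v insertI2[OF insertI1]] by (auto simp: measure_pmf_zero_iff)
  then obtain x where x: "x \<in> set_pmf (cond_local \<mu> S y {i, j})" "x j = b" by blast
  have yj: "y j = b" if "j \<in> S" using set_cond_local(2)[OF v x(1)] x(2) that by (auto simp: restrict_def)
  \<comment> \<open>Conditioning on the enlarged seed means conditioning on the old seed and on
    \<open>X_j = b\<close> at once; \<open>yj\<close> settles the case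
    \<open>j \<in> S\<close>.\<close>
  have cond: "{x. restrict x (insert j S) = y(j := b)} = ?Y \<inter> ?B"
  proof (intro equalityI subsetI)
    fix x assume x: "x \<in> {x. restrict x (insert j S) = y(j := b)}"
    hence eq: "restrict x (insert j S) t = (y(j := b)) t" for t by simp
    have xj: "x j = b" using eq[of j] by simp
    have "x t = y t" if "t \<in> S" for t
    proof (cases "t = j")
      case True
      thus ?thesis using xj yj that by simp
    next
      case False
      thus ?thesis using eq[of t] that by simp
    qed
    hence "restrict x S = y"
      by (intro extensionalityI[OF restrict_extensional ext]) simp
    with xj show "x \<in> ?Y \<inter> ?B" by simp
  next
    fix x assume "x \<in> ?Y \<inter> ?B"
    hence "x j = b" "restrict x S = y" by simp_all
    hence x: "x j = b" "\<And>t. restrict x S t = y t" by simp_all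
    have "restrict x (insert j S) t = (y(j := b)) t" for t
      using x(1) x(2)[of t] by (auto simp: restrict_def)
    thus "x \<in> {x. restrict x (insert j S) = y(j := b)}" by (simp add: fun_eq_iff)
  qed
  have U: "insert j S \<union> {i} = ?U" by auto
  have ne: "set_pmf (\<mu> ?U) \<inter> (?Y \<inter> ?B) \<noteq> {}"
    using set_cond_local[OF v x(1)] x(2) by auto
  have "cprob (insert j S) (y(j := b)) (i, a)
      = measure_pmf.prob (\<mu> ?U) ((?Y \<inter> ?B) \<inter> ?A) / measure_pmf.prob (\<mu> ?U) (?Y \<inter> ?B)"
    unfolding cprob_def cond_local_def prod.case U cond by (rule measure_cond_pmf[OF ne])
  also have "(?Y \<inter> ?B) \<inter> ?A = ?Y \<inter> {x. x i = a \<and> x j = b}" by auto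
  also have "measure_pmf.prob (\<mu> ?U) (?Y \<inter> {x. x i = a \<and> x j = b})
      = cjoint S y (i, a) (j, b) * measure_pmf.prob (\<mu> ?U) ?Y"
    unfolding cjoint_def cond_local_def prod.case measure_cond_pmf[OF cond_nonempty[OF v]]
    using measure_measure_pmf_not_zero[OF cond_nonempty[OF v]] by simp
  also have "measure_pmf.prob (\<mu> ?U) (?Y \<inter> ?B) = cprob S y (j, b) * measure_pmf.prob (\<mu> ?U) ?Y"
    unfolding cprob_eq[OF v insertI2[OF insertI1]] cond_local_def measure_cond_pmf[OF cond_nonempty[OF v]]
    using measure_measure_pmf_not_zero[OF cond_nonempty[OF v]] by simp
  also have "cjoint S y (i, a) (j, b) * measure_pmf.prob (\<mu> ?U) ?Y / (cprob S y (j, b) * measure_pmf.prob (\<mu> ?U) ?Y)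
      = cjoint S y (i, a) (j, b) / cprob S y (j, b)"
    using measure_measure_pmf_not_zero[OF cond_nonempty[OF v]] by simp
  finally show ?thesis .
qed

section \<open>Expected collision probability as a potential\<close>

definition collision :: "nat set \<Rightarrow> (nat \<Rightarrow> nat) \<Rightarrow> nat \<Rightarrow> real" where
  "collision S y i = (\<Sum>a<k. (cprob S y (i, a))\<^sup>2)"

definition potential :: "nat set \<Rightarrow> nat \<Rightarrow> real" where
  "potential S i = measure_pmf.expectation (\<mu> S) (\<lambda>y. collision S y i)"

definition cgain :: "nat set \<Rightarrow> (nat \<Rightarrow> nat) \<Rightarrow> nat \<Rightarrow> nat \<Rightarrow> real" where
  "cgain S y = pairwise_marginals.gain k (cjoint S y) (cprob S y)"

lemma collision_nonneg: "0 \<le> collision S y i"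
  by (simp add: collision_def sum_nonneg)

lemma collision_le_1: "collision S y i \<le> 1"
proof -
  let ?q = "cond_local \<mu> S y {i}"
  have "collision S y i \<le> (\<Sum>a<k. cprob S y (i, a))"
    unfolding collision_def power2_eq_square
    by (intro sum_mono) (auto simp: cprob_def intro: mult_left_le)
  also have "\<dots> = measure_pmf.prob ?q (\<Union>a<k. {x. x i = a})"
    unfolding cprob_def prod.case
    by (rule measure_pmf.finite_measure_finite_Union[symmetric]) (auto simp: disjoint_family_on_def)
  also have "\<dots> \<le> 1" by simp
  finally show ?thesis .
qed

text \<open>By the chain rule, averaging the new collision probability over \<open>X_j\<close> gives
  the double sum in \<open>gain_eq\<close>, that is, the old value plus the gain.\<close>

lemma expectation_collision_insert:
  assumes S: "S \<subseteq> {..<n}" "card S \<le> r" "y \<in> set_pmf (\<mu> S)" and ij: "i < n" "j < n"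
  shows "measure_pmf.expectation (cond_local \<mu> S y {j}) (\<lambda>x. collision (insert j S) x i)
    = collision S y i + cgain S y i j"
proof -
  interpret pairwise_marginals n k "cjoint S y" "cprob S y" by (rule pairwise_marginals_cond[OF S])
  note v = valid_single[OF S ij(2)]
  let ?q = "cond_local \<mu> S y {j}"
  \<comment> \<open>A conditional sample is \<open>y\<close> with its value at \<open>j\<close>
    filled in, so the expectation is a finite sum over that value.\<close>
  have upd: "x = y(j := x j)" if "x \<in> set_pmf ?q" for x
  proof
    fix t
    have x: "x \<in> extensional (insert j S)" "\<And>t. restrict x S t = y t"
      using set_cond_local[OF v that] by (auto simp: PiE_def)
    have "y \<in> extensional S" using S set_local[of S] by (auto simp: PiE_def)
    thus "x t = (y(j := x j)) t"
      using x(1) x(2)[of t] by (cases "t \<in> S") (auto simp: extensional_def)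
  qed
  have bound: "x j < k" if "x \<in> set_pmf ?q" for x using set_cond_local(1)[OF v that] by auto
  have "measure_pmf.expectation ?q (\<lambda>x. collision (insert j S) x i)
      = measure_pmf.expectation ?q (\<lambda>x. collision (insert j S) (y(j := x j)) i)"
    by (rule expectation_cong_set_pmf) (use upd in metis)
  also have "\<dots> = measure_pmf.expectation (map_pmf (\<lambda>x. x j) ?q) (\<lambda>b. collision (insert j S) (y(j := b)) i)"
    by simp
  also have "\<dots> = (\<Sum>b<k. collision (insert j S) (y(j := b)) i * cprob S y (j, b))"
    using bound by (subst integral_measure_pmf_real[where A = "{..<k}"]) (auto simp: pmf_map_coordinate cprob_def)
  also have "\<dots> = (\<Sum>b<k. \<Sum>a<k. (cjoint S y (i, a) (j, b))\<^sup>2 / cprob S y (j, b))"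
  proof (intro sum.cong refl)
    fix b assume "b \<in> {..<k}"
    show "collision (insert j S) (y(j := b)) i * cprob S y (j, b)
        = (\<Sum>a<k. (cjoint S y (i, a) (j, b))\<^sup>2 / cprob S y (j, b))"
    \<comment> \<open>A value \<open>b\<close> of probability zero contributes \<open>0\<close> on
      both sides, on the right through division by zero.\<close>
    proof (cases "cprob S y (j, b) = 0")
      case False
      thus ?thesis
        by (simp add: collision_def cprob_insert[OF S ij False] sum_distrib_right power2_eq_square)
    qed simp
  qed
  also have "\<dots> = (\<Sum>a<k. \<Sum>b<k. (cjoint S y (i, a) (j, b))\<^sup>2 / cprob S y (j, b))" by (rule sum.swap)
  also have "\<dots> = collision S y i + cgain S y i j"
    using gain_eq[OF ij] by (simp add: collision_def cgain_def)
  finally show ?thesis .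
qed

text \<open>Extending a random assignment of \<open>S\<close> by a conditional sample at
  \<open>j\<close> yields a sample of \<open>\<mu> (insert j S)\<close>, so the identity for fixed
  \<open>y\<close> can be averaged.\<close>

lemma potential_insert:
  assumes S: "S \<subseteq> {..<n}" "card S \<le> r" and ij: "i < n" "j < n"
  shows "potential (insert j S) i = potential S i + measure_pmf.expectation (\<mu> S) (\<lambda>y. cgain S y i j)"
proof -
  have "finite S" using S(1) finite_subset by blast
  hence card: "card (S \<union> {j}) \<le> r + 2" using S by (simp add: card_insert_if)
  have fin: "finite (set_pmf (\<mu> S))" using S by (intro finite_set_local) auto
  have "potential (insert j S) i
      = measure_pmf.expectation (bind_pmf (\<mu> S) (\<lambda>y. cond_local \<mu> S y {j})) (\<lambda>x. collision (insert j S) x i)"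
    unfolding potential_def using S ij card by (subst bind_cond_local) auto
  also have "\<dots> = measure_pmf.expectation (\<mu> S)
      (\<lambda>y. measure_pmf.expectation (cond_local \<mu> S y {j}) (\<lambda>x. collision (insert j S) x i))"
    using fin finite_set_cond_local valid_single S ij by (intro expectation_bind_pmf_finite) auto
  also have "\<dots> = measure_pmf.expectation (\<mu> S) (\<lambda>y. collision S y i + cgain S y i j)"
    by (rule expectation_cong_set_pmf) (rule expectation_collision_insert[OF S _ ij])
  also have "\<dots> = potential S i + measure_pmf.expectation (\<mu> S) (\<lambda>y. cgain S y i j)"
    using fin by (simp add: potential_def integrable_measure_pmf_finite)
  finally show ?thesis .
qed

lemma potential_bounds: "0 \<le> potential S i" "potential S i \<le> 1"
proof -
  show "0 \<le> potential S i" by (simp add: potential_def collision_nonneg)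
  have "potential S i \<le> measure_pmf.expectation (\<mu> S) (\<lambda>_. 1)"
    unfolding potential_def
    by (intro integral_mono measure_pmf.integrable_const_bound[where B = 1])
      (auto simp: collision_nonneg collision_le_1)
  thus "potential S i \<le> 1" by simp
qed

end

section \<open>Propagation sampling\<close>

text \<open>The triangle inequality for the integral at each point; it serves to compare two
  mixtures over the same random seed.\<close>

lemma l1_dist_on_bind_le:
  assumes "finite (set_pmf N)"
  shows "l1_dist_on A (bind_pmf N f) (bind_pmf N g)
    \<le> measure_pmf.expectation N (\<lambda>x. l1_dist_on A (f x) (g x))"
proof -
  have [simp]: "integrable (measure_pmf N) h" for h :: "'a \<Rightarrow> real"
    using assms by (rule integrable_measure_pmf_finite)
  have "\<bar>pmf (bind_pmf N f) a - pmf (bind_pmf N g) a\<bar>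
      \<le> measure_pmf.expectation N (\<lambda>x. \<bar>pmf (f x) a - pmf (g x) a\<bar>)" for a
  proof -
    have "pmf (bind_pmf N f) a - pmf (bind_pmf N g) a
        = measure_pmf.expectation N (\<lambda>x. pmf (f x) a - pmf (g x) a)"
      unfolding pmf_bind by (rule Bochner_Integration.integral_diff[symmetric]) simp_all
    thus ?thesis using integral_abs_bound[of "measure_pmf N" "\<lambda>x. pmf (f x) a - pmf (g x) a"] by simp
  qed
  hence "l1_dist_on A (bind_pmf N f) (bind_pmf N g)
      \<le> (\<Sum>a\<in>A. measure_pmf.expectation N (\<lambda>x. \<bar>pmf (f x) a - pmf (g x) a\<bar>))"
    unfolding l1_dist_on_def by (intro sum_mono) auto
  also have "\<dots> = measure_pmf.expectation N (\<lambda>x. l1_dist_on A (f x) (g x))"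
    unfolding l1_dist_on_def by (rule Bochner_Integration.integral_sum[symmetric]) simp
  finally show ?thesis .
qed

lemma l1_dist_on_le_2:
  assumes "finite A"
  shows "l1_dist_on A p q \<le> 2"
proof -
  have mass: "(\<Sum>a\<in>A. pmf p a) \<le> 1" for p :: "'a pmf"
    using measure_measure_pmf_finite[OF assms, of p] by (metis measure_pmf.prob_le_1)
  have "l1_dist_on A p q \<le> (\<Sum>a\<in>A. pmf p a + pmf q a)"
    unfolding l1_dist_on_def
  proof (rule sum_mono)
    fix a
    have "0 \<le> pmf p a" "0 \<le> pmf q a" by simp_all
    thus "\<bar>pmf p a - pmf q a\<bar> \<le> pmf p a + pmf q a" by linarith
  qed
  thus ?thesis using mass[of p] mass[of q] by (simp add: sum.distrib)
qed

lemma edge_expectation_mono: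
  assumes "regular_graph n G" "\<And>i j. i < n \<Longrightarrow> j < n \<Longrightarrow> f i j \<le> g i j"
  shows "edge_expectation n G f \<le> edge_expectation n G g"
  unfolding edge_expectation_def using assms
  by (intro sum_mono mult_left_mono) (auto simp: regular_graph_def)

lemma edge_expectation_const:
  assumes "regular_graph n G" "0 < n"
  shows "edge_expectation n G (\<lambda>i j. c) = c"
  using assms by (simp add: edge_expectation_def regular_graph_def sum_distrib_right[symmetric])

lemma edge_expectation_expectation:
  assumes "finite (set_pmf N)"
  shows "edge_expectation n G (\<lambda>i j. measure_pmf.expectation N (\<lambda>x. f x i j))
    = measure_pmf.expectation N (\<lambda>x. edge_expectation n G (f x))"
proof -
  have [simp]: "integrable (measure_pmf N) h" for h :: "'a \<Rightarrow> real"
    using assms by (rule integrable_measure_pmf_finite)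
  show ?thesis by (simp add: edge_expectation_def)
qed

text \<open>Matches drawing one more vertex with passing from seed lists of length \<open>m\<close>
  to length \<open>Suc m\<close>.\<close>

lemma sum_lists_length_Suc:
  fixes f :: "'a list \<Rightarrow> real"
  shows "(\<Sum>vs | set vs \<subseteq> A \<and> length vs = Suc m. f vs)
    = (\<Sum>vs | set vs \<subseteq> A \<and> length vs = m. \<Sum>v\<in>A. f (v # vs))"
proof -
  have "inj_on (\<lambda>(xs, v). v # xs) ({vs. set vs \<subseteq> A \<and> length vs = m} \<times> A)"
    by (auto simp: inj_on_def)
  thus ?thesis
    unfolding lists_length_Suc_eq
    by (simp add: sum.reindex sum.cartesian_product split_def)
qed

context local_random_variables
begin

section \<open>Separating the random seed from the propagation step\<close>

definition propagate :: "nat set \<Rightarrow> (nat \<Rightarrow> nat) \<Rightarrow> (nat \<Rightarrow> nat) pmf" where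
  "propagate S y = map_pmf (\<lambda>z i. if i \<in> S then y i else z i)
     (Pi_pmf ({..<n} - S) undefined (\<lambda>i. map_pmf (\<lambda>x. x i) (cond_local \<mu> S y {i})))"

definition seeds :: "nat \<Rightarrow> nat list set" where
  "seeds m = {vs. set vs \<subseteq> {..<n} \<and> length vs = m}"

text \<open>Set and assignment are recorded jointly, so that the true and the sampled distribution
  become mixtures over one space.\<close>

definition seeded :: "nat \<Rightarrow> (nat set \<times> (nat \<Rightarrow> nat)) pmf" where
  "seeded m = bind_pmf (pmf_of_set (seeds m)) (\<lambda>vs. map_pmf (Pair (set vs)) (\<mu> (set vs)))"

definition seed :: "(nat set \<times> (nat \<Rightarrow> nat)) pmf" where
  "seed = bind_pmf (pmf_of_set {1..r}) seeded"

lemma propagation_sampling_eq: "propagation_sampling n r \<mu> = bind_pmf seed (\<lambda>(S, y). propagate S y)"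
  by (simp add: propagation_sampling_def seed_def seeded_def seeds_def propagate_def Let_def
      bind_assoc_pmf bind_map_pmf)

text \<open>Given the seed its own coordinates are constant, which lets seed vertices be treated
  like the independently sampled ones.\<close>

lemma map_cond_local_fixed:
  assumes "valid S y {i}" "i \<in> S"
  shows "map_pmf (\<lambda>x. x i) (cond_local \<mu> S y {i}) = return_pmf (y i)"
proof -
  have "map_pmf (\<lambda>x. x i) (cond_local \<mu> S y {i}) = map_pmf (\<lambda>_. y i) (cond_local \<mu> S y {i})"
  proof (intro map_pmf_cong refl)
    fix x assume "x \<in> set_pmf (cond_local \<mu> S y {i})"
    from fun_cong[OF set_cond_local(2)[OF assms(1) this], of i] show "x i = y i" using assms(2) by simp
  qed
  thus ?thesis by (simp add: map_pmf_const)
qed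

lemma propagate_marginal:
  assumes v: "valid S y {i}" and i: "i < n"
  shows "map_pmf (\<lambda>x. x i) (propagate S y) = map_pmf (\<lambda>x. x i) (cond_local \<mu> S y {i})"
proof (cases "i \<in> S")
  case True
  thus ?thesis by (simp add: propagate_def pmf.map_comp o_def map_cond_local_fixed[OF v])
next
  case False
  thus ?thesis using i by (simp add: propagate_def pmf.map_comp o_def Pi_pmf_component)
qed

text \<open>Seed coordinates are point masses, hence independent of everything, and two distinct
  other vertices are different coordinates of a product measure.\<close>

lemma propagate_pair:
  assumes v: "valid S y {i}" "valid S y {j}" and ij: "i < n" "j < n" "i \<noteq> j"
  shows "map_pmf (\<lambda>x. (x i, x j)) (propagate S y)
    = pair_pmf (map_pmf (\<lambda>x. x i) (cond_local \<mu> S y {i})) (map_pmf (\<lambda>x. x j) (cond_local \<mu> S y {j}))"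
proof -
  define q where "q i = map_pmf (\<lambda>x. x i) (cond_local \<mu> S y {i})" for i
  define A where "A = {..<n} - S"
  have fin: "finite A" by (simp add: A_def)
  have ext: "propagate S y = map_pmf (\<lambda>z i. if i \<in> S then y i else z i) (Pi_pmf A undefined q)"
    by (simp add: propagate_def A_def q_def[abs_def])
  have fixed: "q l = return_pmf (y l)" if "l \<in> S" "l = i \<or> l = j" for l
    using map_cond_local_fixed[of S y l] v that by (auto simp: q_def)
  have comp: "map_pmf (\<lambda>f. f l) (Pi_pmf A undefined q) = q l" if "l \<in> A" for l
    using that fin by (simp add: Pi_pmf_component)
  have "map_pmf (\<lambda>x. (x i, x j)) (propagate S y) = pair_pmf (q i) (q j)"
  proof (cases "i \<in> S")
    case iS: True
    show ?thesis
    proof (cases "j \<in> S")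
      case True
      thus ?thesis using iS by (simp add: ext pmf.map_comp o_def fixed pair_return_pmf1)
    next
      case False
      hence "j \<in> A" using ij by (simp add: A_def)
      have "map_pmf (\<lambda>x. (x i, x j)) (propagate S y)
          = map_pmf (Pair (y i)) (map_pmf (\<lambda>f. f j) (Pi_pmf A undefined q))"
        using iS False by (simp add: ext pmf.map_comp o_def)
      thus ?thesis using iS by (simp add: comp[OF \<open>j \<in> A\<close>] fixed pair_return_pmf1)
    qed
  next
    case iS: False
    hence iA: "i \<in> A" using ij by (simp add: A_def)
    show ?thesis
    proof (cases "j \<in> S")
      case True
      have "map_pmf (\<lambda>x. (x i, x j)) (propagate S y)
          = map_pmf (\<lambda>a. (a, y j)) (map_pmf (\<lambda>f. f i) (Pi_pmf A undefined q))"
        using iS True by (simp add: ext pmf.map_comp o_def)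
      thus ?thesis using True by (simp add: comp[OF iA] fixed pair_return_pmf2)
    next
      case False
      hence jA: "j \<in> A - {i}" using ij by (simp add: A_def)
      have A: "insert i (A - {i}) = A" using iA by blast
      have "map_pmf (\<lambda>x. (x i, x j)) (propagate S y) = map_pmf (\<lambda>f. (f i, f j)) (Pi_pmf (insert i (A - {i})) undefined q)"
        unfolding A using iS False by (simp add: ext pmf.map_comp o_def)
      \<comment> \<open>Splitting coordinate \<open>i\<close> off the product leaves
        \<open>f j\<close> untouched, since \<open>i \<noteq> j\<close>.\<close>
      also have "\<dots> = map_pmf (apsnd (\<lambda>f. f j)) (pair_pmf (q i) (Pi_pmf (A - {i}) undefined q))"
        using fin ij(3) by (subst Pi_pmf_insert) (auto simp: pmf.map_comp o_def split_def intro!: map_pmf_cong)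
      also have "\<dots> = pair_pmf (q i) (map_pmf (\<lambda>f. f j) (Pi_pmf (A - {i}) undefined q))"
        by (simp add: pair_map_pmf2)
      also have "\<dots> = pair_pmf (q i) (q j)" using fin jA by (simp add: Pi_pmf_component)
      finally show ?thesis .
    qed
  qed
  thus ?thesis by (simp add: q_def)
qed

definition ccorr :: "nat set \<Rightarrow> (nat \<Rightarrow> nat) \<Rightarrow> nat \<Rightarrow> nat \<Rightarrow> real" where
  "ccorr S y = pairwise_marginals.corr k (cjoint S y) (cprob S y)"

text \<open>For \<open>i \<noteq> j\<close> the propagated pair is the product of the conditional
  marginals, so the distance is \<open>ccorr\<close> itself; for \<open>i = j\<close> both pairs are
  diagonal copies of one marginal and the distance is zero.\<close>

lemma l1_dist_propagate_le:
  assumes S: "S \<subseteq> {..<n}" "card S \<le> r" "y \<in> set_pmf (\<mu> S)" and ij: "i < n" "j < n"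
  shows "l1_dist_on ({..<k} \<times> {..<k}) (pair_dist (cond_local \<mu> S y {i, j}) i j) (pair_dist (propagate S y) i j)
    \<le> ccorr S y i j"
proof -
  interpret pairwise_marginals n k "cjoint S y" "cprob S y" by (rule pairwise_marginals_cond[OF S])
  note v = valid_single[OF S ij(1)] valid_single[OF S ij(2)]
  show ?thesis
  proof (cases "i = j")
    case True
    have "map_pmf (\<lambda>a. (a, a)) (map_pmf (\<lambda>x. x i) (propagate S y))
        = map_pmf (\<lambda>a. (a, a)) (map_pmf (\<lambda>x. x i) (cond_local \<mu> S y {i}))"
      using propagate_marginal[OF v(1) ij(1)] by simp
    hence "pair_dist (cond_local \<mu> S y {i, j}) i j = pair_dist (propagate S y) i j"
      using True by (simp add: pair_dist_def pmf.map_comp o_def)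
    moreover have "0 \<le> corr i j" by (simp add: corr_def sum_nonneg)
    ultimately show ?thesis by (simp add: l1_dist_on_def ccorr_def)
  next
    case False
    have "pmf (pair_dist (cond_local \<mu> S y {i, j}) i j) (a, b) = cjoint S y (i, a) (j, b)" for a b
      by (simp add: pair_dist_def pmf_map vimage_def cjoint_def)
    moreover have "pmf (pair_dist (propagate S y) i j) (a, b) = cprob S y (i, a) * cprob S y (j, b)" for a b
      using propagate_pair[OF v ij False] by (simp add: pair_dist_def pmf_pair pmf_map_coordinate cprob_def)
    ultimately have "\<bar>pmf (pair_dist (cond_local \<mu> S y {i, j}) i j) x - pmf (pair_dist (propagate S y) i j) x\<bar>
        = (\<lambda>(a, b). \<bar>cov (i, a) (j, b)\<bar>) x" for x
      by (cases x) (simp add: cov_def)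
    thus ?thesis by (simp add: l1_dist_on_def ccorr_def corr_def sum.cartesian_product)
  qed
qed

lemma finite_seeds: "finite (seeds m)"
  unfolding seeds_def by (rule finite_lists_length_eq) simp

lemma card_seeds: "card (seeds m) = n ^ m"
  unfolding seeds_def by (subst card_lists_length_eq) simp_all

lemma seeds_nonempty: "0 < n \<Longrightarrow> seeds m \<noteq> {}"
  using card_seeds[of m] by (metis card.empty less_numeral_extra(3) zero_less_power)

lemma card_set_seeds: "vs \<in> seeds m \<Longrightarrow> card (set vs) \<le> m"
  by (auto simp: seeds_def card_length)

lemma set_seeded:
  assumes "0 < n" "(S, y) \<in> set_pmf (seeded m)"
  shows "S \<subseteq> {..<n}" "card S \<le> m" "y \<in> set_pmf (\<mu> S)"
  using assms finite_seeds[of m] seeds_nonempty[OF assms(1), of m] card_set_seeds[of _ m]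
  by (auto simp: seeded_def seeds_def)

lemma set_seed:
  assumes "0 < n" "0 < r" "(S, y) \<in> set_pmf seed"
  shows "S \<subseteq> {..<n}" "card S \<le> r" "y \<in> set_pmf (\<mu> S)"
proof -
  have "{1..r} \<noteq> {}" using assms(2) by simp
  then obtain m where "m \<le> r" "(S, y) \<in> set_pmf (seeded m)"
    using assms(3) by (auto simp: seed_def)
  thus "S \<subseteq> {..<n}" "card S \<le> r" "y \<in> set_pmf (\<mu> S)"
    using set_seeded[OF assms(1), of S y m] by auto
qed

lemma finite_set_seeded:
  assumes "0 < n" "m \<le> r"
  shows "finite (set_pmf (seeded m))"
proof -
  have "finite (set_pmf (\<mu> (set vs)))" if "vs \<in> seeds m" for vs
    using that card_set_seeds[OF that] assms by (intro finite_set_local) (auto simp: seeds_def)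
  thus ?thesis using finite_seeds seeds_nonempty[OF assms(1)] by (simp add: seeded_def)
qed

lemma finite_set_seed:
  assumes "0 < n" "0 < r"
  shows "finite (set_pmf seed)"
proof -
  have "{1..r} \<noteq> {}" using assms(2) by simp
  thus ?thesis using finite_set_seeded[OF assms(1)] by (simp add: seed_def)
qed

text \<open>By total probability, drawing a seed and then conditioning on it restores the original
  pair distribution, whichever seed set was drawn.\<close>

lemma pair_dist_seed:
  assumes "0 < n" "0 < r" and ij: "i < n" "j < n"
  shows "pair_dist (\<mu> {i, j}) i j = bind_pmf seed (\<lambda>(S, y). pair_dist (cond_local \<mu> S y {i, j}) i j)"
proof -
  have ne: "{1..r} \<noteq> {}" using assms(2) by simp
  have seed_step: "bind_pmf (\<mu> S) (\<lambda>y. pair_dist (cond_local \<mu> S y {i, j}) i j) = pair_dist (\<mu> {i, j}) i j"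
    if S: "S \<subseteq> {..<n}" "card S \<le> r" for S
  proof -
    have U: "S \<union> {i, j} \<subseteq> {..<n}" "card (S \<union> {i, j}) \<le> r + 2"
      using S ij card_union_pair[OF S(2)] by auto
    have "bind_pmf (\<mu> S) (\<lambda>y. pair_dist (cond_local \<mu> S y {i, j}) i j) = pair_dist (\<mu> (S \<union> {i, j})) i j"
      unfolding pair_dist_def map_bind_pmf[symmetric] using S U by (subst bind_cond_local) auto
    also have "\<dots> = pair_dist (map_pmf (\<lambda>x. restrict x {i, j}) (\<mu> (S \<union> {i, j}))) i j"
      by (simp add: pair_dist_def pmf.map_comp o_def)
    also have "\<dots> = pair_dist (\<mu> {i, j}) i j" using U by (subst local_marginal) auto
    finally show ?thesis .
  qed
  have "bind_pmf seed (\<lambda>(S, y). pair_dist (cond_local \<mu> S y {i, j}) i j)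
      = bind_pmf (pmf_of_set {1..r}) (\<lambda>m. bind_pmf (pmf_of_set (seeds m)) (\<lambda>vs.
          bind_pmf (\<mu> (set vs)) (\<lambda>y. pair_dist (cond_local \<mu> (set vs) y {i, j}) i j)))"
    by (simp add: seed_def seeded_def bind_assoc_pmf bind_map_pmf)
  also have "\<dots> = bind_pmf (pmf_of_set {1..r}) (\<lambda>m. bind_pmf (pmf_of_set (seeds m)) (\<lambda>vs.
          pair_dist (\<mu> {i, j}) i j))"
  proof (intro bind_pmf_cong refl)
    fix m vs assume "m \<in> set_pmf (pmf_of_set {1..r})" "vs \<in> set_pmf (pmf_of_set (seeds m))"
    hence "m \<le> r" "vs \<in> seeds m" using ne finite_seeds seeds_nonempty[OF assms(1)] by auto
    thus "bind_pmf (\<mu> (set vs)) (\<lambda>y. pair_dist (cond_local \<mu> (set vs) y {i, j}) i j) = pair_dist (\<mu> {i, j}) i j"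
      using card_set_seeds[of vs m] by (intro seed_step) (auto simp: seeds_def)
  qed
  finally show ?thesis by simp
qed

section \<open>Telescoping of the average potential over the seed size\<close>

definition avg_potential :: "nat \<Rightarrow> real" where
  "avg_potential m = (\<Sum>vs\<in>seeds m. \<Sum>i<n. potential (set vs) i) / real n ^ Suc m"

lemma avg_potential_bounds:
  assumes "0 < n"
  shows "0 \<le> avg_potential m" "avg_potential m \<le> 1"
proof -
  show "0 \<le> avg_potential m"
    by (simp add: avg_potential_def sum_nonneg potential_bounds)
  have "(\<Sum>vs\<in>seeds m. \<Sum>i<n. potential (set vs) i) \<le> (\<Sum>vs\<in>seeds m. \<Sum>i<n. 1)"
    using potential_bounds by (intro sum_mono) auto
  \<comment> \<open>\<open>n ^ m\<close> seed lists, counted with their repetitions, times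
    \<open>n\<close> vertices \<open>i\<close>.\<close>
  also have "\<dots> = real n ^ Suc m" by (simp add: card_seeds)
  finally show "avg_potential m \<le> 1" using assms by (simp add: avg_potential_def divide_le_eq)
qed

text \<open>A uniform list of length \<open>m\<close> with a uniform vertex in front is a uniform
  list of length \<open>Suc m\<close>, so the total gain is an increment of the average
  potential.\<close>

lemma expectation_gain_seeded:
  assumes "0 < n" "m \<le> r"
  shows "measure_pmf.expectation (seeded m) (\<lambda>(S, y). \<Sum>i<n. \<Sum>j<n. cgain S y i j)
    = (real n)\<^sup>2 * (avg_potential (Suc m) - avg_potential m)"
proof -
  have vs: "set vs \<subseteq> {..<n}" "card (set vs) \<le> r" if "vs \<in> seeds m" for vs
    using that card_set_seeds[OF that] assms(2) by (auto simp: seeds_def)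
  have fin: "finite (set_pmf (\<mu> (set vs)))" if "vs \<in> seeds m" for vs
    using vs[OF that] by (intro finite_set_local) auto
  have "measure_pmf.expectation (seeded m) (\<lambda>(S, y). \<Sum>i<n. \<Sum>j<n. cgain S y i j)
      = (\<Sum>vs\<in>seeds m. measure_pmf.expectation (\<mu> (set vs)) (\<lambda>y. \<Sum>i<n. \<Sum>j<n. cgain (set vs) y i j)) / real n ^ m"
    unfolding seeded_def using finite_seeds seeds_nonempty[OF assms(1)] fin
    by (subst pmf_expectation_bind_pmf_of_set) (auto simp: card_seeds sum_divide_distrib field_simps)
  also have "(\<Sum>vs\<in>seeds m. measure_pmf.expectation (\<mu> (set vs)) (\<lambda>y. \<Sum>i<n. \<Sum>j<n. cgain (set vs) y i j))
      = (\<Sum>vs\<in>seeds m. \<Sum>i<n. \<Sum>j<n. potential (insert j (set vs)) i - potential (set vs) i)"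
  proof (rule sum.cong[OF refl])
    fix ws assume ws: "ws \<in> seeds m"
    have "measure_pmf.expectation (\<mu> (set ws)) (\<lambda>y. \<Sum>i<n. \<Sum>j<n. cgain (set ws) y i j)
        = (\<Sum>i<n. \<Sum>j<n. measure_pmf.expectation (\<mu> (set ws)) (\<lambda>y. cgain (set ws) y i j))"
    proof -
      have [simp]: "integrable (measure_pmf (\<mu> (set ws))) h" for h :: "(nat \<Rightarrow> nat) \<Rightarrow> real"
        using fin[OF ws] by (rule integrable_measure_pmf_finite)
      show ?thesis by simp
    qed
    also have "\<dots> = (\<Sum>i<n. \<Sum>j<n. potential (insert j (set ws)) i - potential (set ws) i)"
      using potential_insert[OF vs[OF ws]] by (intro sum.cong refl) auto
    finally show "measure_pmf.expectation (\<mu> (set ws)) (\<lambda>y. \<Sum>i<n. \<Sum>j<n. cgain (set ws) y i j)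
        = (\<Sum>i<n. \<Sum>j<n. potential (insert j (set ws)) i - potential (set ws) i)" .
  qed
  also have "\<dots> = (\<Sum>vs\<in>seeds m. \<Sum>i<n. \<Sum>j<n. potential (insert j (set vs)) i)
      - real n * (\<Sum>vs\<in>seeds m. \<Sum>i<n. potential (set vs) i)"
    by (simp add: sum_subtractf sum_distrib_left)
  \<comment> \<open>Brings the new vertex \<open>j\<close> next to \<open>vs\<close>, so that both
    form one longer list.\<close>
  also have "(\<Sum>vs\<in>seeds m. \<Sum>i<n. \<Sum>j<n. potential (insert j (set vs)) i)
      = (\<Sum>vs\<in>seeds m. \<Sum>j<n. \<Sum>i<n. potential (insert j (set vs)) i)"
    by (rule sum.cong[OF refl], rule sum.swap)
  also have "\<dots> = (\<Sum>vs\<in>seeds (Suc m). \<Sum>i<n. potential (set vs) i)"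
    unfolding seeds_def sum_lists_length_Suc by simp
  finally have "measure_pmf.expectation (seeded m) (\<lambda>(S, y). \<Sum>i<n. \<Sum>j<n. cgain S y i j)
      = ((\<Sum>vs\<in>seeds (Suc m). \<Sum>i<n. potential (set vs) i)
        - real n * (\<Sum>vs\<in>seeds m. \<Sum>i<n. potential (set vs) i)) / real n ^ m" .
  moreover have "(A - real n * B) / real n ^ m = (real n)\<^sup>2 * (A / real n ^ Suc (Suc m) - B / real n ^ Suc m)"
    for A B using assms(1) by (simp add: field_simps power2_eq_square)
  ultimately show ?thesis by (simp only: avg_potential_def)
qed

text \<open>The increments telescope to a difference of two numbers in \<open>[0, 1]\<close>; the
  uniform choice of the seed size contributes \<open>1 / r\<close>.\<close>

lemma expectation_gain_seed:
  assumes "0 < n" "0 < r"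
  shows "measure_pmf.expectation seed (\<lambda>(S, y). \<Sum>i<n. \<Sum>j<n. cgain S y i j) \<le> (real n)\<^sup>2 / real r"
proof -
  have "{1..r} \<noteq> {}" using assms(2) by simp
  hence "measure_pmf.expectation seed (\<lambda>(S, y). \<Sum>i<n. \<Sum>j<n. cgain S y i j)
      = (\<Sum>m = 1..r. measure_pmf.expectation (seeded m) (\<lambda>(S, y). \<Sum>i<n. \<Sum>j<n. cgain S y i j)) / real r"
    unfolding seed_def using finite_set_seeded[OF assms(1)]
    by (subst pmf_expectation_bind_pmf_of_set) (auto simp: sum_divide_distrib field_simps)
  also have "(\<Sum>m = 1..r. measure_pmf.expectation (seeded m) (\<lambda>(S, y). \<Sum>i<n. \<Sum>j<n. cgain S y i j))
      = (real n)\<^sup>2 * (\<Sum>m = 1..r. avg_potential (Suc m) - avg_potential m)"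
    unfolding sum_distrib_left using expectation_gain_seeded[OF assms(1)] by (intro sum.cong) auto
  \<comment> \<open>The last term involves lists of length \<open>r + 1\<close>, one longer than
    those sampled; with a further vertex \<open>i\<close> they still fit into
    \<open>r + 2\<close>.\<close>
  also have "(\<Sum>m = 1..r. avg_potential (Suc m) - avg_potential m) = avg_potential (Suc r) - avg_potential 1"
    using assms(2) by (subst sum_Suc_diff) auto
  also have "(real n)\<^sup>2 * (avg_potential (Suc r) - avg_potential 1) / real r \<le> (real n)\<^sup>2 * 1 / real r"
    using avg_potential_bounds[OF assms(1), of "Suc r"] avg_potential_bounds[OF assms(1), of 1]
    by (intro divide_right_mono mult_left_mono) auto
  finally show ?thesis by simp
qed

text \<open>Both pair distributions are mixtures over the seed, so the claim reduces to the
  correlation bound of each seed and the expected total gain.\<close>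

lemma edge_expectation_propagation_le:
  assumes G: "regular_graph n G"
    and psd: "\<And>S y. S \<subseteq> {..<n} \<Longrightarrow> card S \<le> r \<Longrightarrow> y \<in> set_pmf (\<mu> S) \<Longrightarrow>
      pos_semidef_on ({..<n} \<times> {..<k}) (cond_cov_matrix \<mu> S y)"
    and pos: "0 < n" "0 < k" "0 < r" "\<epsilon> > 0" "H > 0" "\<tau> \<ge> 0"
  shows "edge_expectation n G (\<lambda>i j. l1_dist_on ({..<k} \<times> {..<k})
      (pair_dist (\<mu> {i, j}) i j) (pair_dist (propagation_sampling n r \<mu>) i j))
    \<le> \<epsilon> / 4 + real k / \<epsilon> * (\<tau> + real (threshold_rank \<tau> G) * H) + 4 / (H * real r)"
proof -
  let ?b = "\<epsilon> / 4 + real k / \<epsilon> * (\<tau> + real (threshold_rank \<tau> G) * H)"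
  let ?gains = "\<lambda>(S, y). \<Sum>i<n. \<Sum>j<n. cgain S y i j"
  have fin: "finite (set_pmf seed)" using pos by (intro finite_set_seed)
  have [simp]: "integrable (measure_pmf seed) h" for h :: "nat set \<times> (nat \<Rightarrow> nat) \<Rightarrow> real"
    using fin by (rule integrable_measure_pmf_finite)
  have "l1_dist_on ({..<k} \<times> {..<k}) (pair_dist (\<mu> {i, j}) i j) (pair_dist (propagation_sampling n r \<mu>) i j)
      \<le> measure_pmf.expectation seed (\<lambda>\<omega>. ccorr (fst \<omega>) (snd \<omega>) i j)" if ij: "i < n" "j < n" for i j
  proof -
    have "pair_dist (propagation_sampling n r \<mu>) i j = bind_pmf seed (\<lambda>(S, y). pair_dist (propagate S y) i j)"
      by (simp add: propagation_sampling_eq pair_dist_def map_bind_pmf split_def)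
    hence "l1_dist_on ({..<k} \<times> {..<k}) (pair_dist (\<mu> {i, j}) i j) (pair_dist (propagation_sampling n r \<mu>) i j)
        \<le> measure_pmf.expectation seed (\<lambda>\<omega>. l1_dist_on ({..<k} \<times> {..<k})
            ((\<lambda>(S, y). pair_dist (cond_local \<mu> S y {i, j}) i j) \<omega>) ((\<lambda>(S, y). pair_dist (propagate S y) i j) \<omega>))"
      using l1_dist_on_bind_le[OF fin] pair_dist_seed[OF pos(1,3) ij] by simp
    also have "\<dots> \<le> measure_pmf.expectation seed (\<lambda>\<omega>. ccorr (fst \<omega>) (snd \<omega>) i j)"
      using l1_dist_propagate_le set_seed[OF pos(1,3)] ij
      by (intro expectation_mono_set_pmf[OF fin]) auto
    finally show ?thesis .
  qed
  hence "edge_expectation n G (\<lambda>i j. l1_dist_on ({..<k} \<times> {..<k})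
        (pair_dist (\<mu> {i, j}) i j) (pair_dist (propagation_sampling n r \<mu>) i j))
      \<le> edge_expectation n G (\<lambda>i j. measure_pmf.expectation seed (\<lambda>\<omega>. ccorr (fst \<omega>) (snd \<omega>) i j))"
    by (rule edge_expectation_mono[OF G])
  also have "\<dots> = measure_pmf.expectation seed (\<lambda>\<omega>. edge_expectation n G (ccorr (fst \<omega>) (snd \<omega>)))"
    by (rule edge_expectation_expectation[OF fin])
  \<comment> \<open>The bound for one seed is affine in its gains, with \<open>H\<close> and
    \<open>\<tau>\<close> the same for all seeds, so it can be averaged directly.\<close>
  also have "\<dots> \<le> measure_pmf.expectation seed (\<lambda>\<omega>. ?b + 4 / H / (real n)\<^sup>2 * ?gains \<omega>)"
  proof (rule expectation_mono_set_pmf[OF fin])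
    fix \<omega> assume "\<omega> \<in> set_pmf seed"
    moreover obtain S y where \<omega>: "\<omega> = (S, y)" by (cases \<omega>)
    ultimately have S: "S \<subseteq> {..<n}" "card S \<le> r" "y \<in> set_pmf (\<mu> S)"
      using set_seed[OF pos(1,3)] by auto
    interpret pairwise_marginals n k "cjoint S y" "cprob S y" by (rule pairwise_marginals_cond[OF S])
    have "pos_semidef_on ({..<n} \<times> {..<k}) cov"
    proof -
      have cov: "cov p q = cond_cov_matrix \<mu> S y p q" if "p \<in> {..<n} \<times> {..<k}" "q \<in> {..<n} \<times> {..<k}" for p q
        using cond_cov_matrix_eq[OF S] that by (auto simp: cov_def)
      show ?thesis using psd[OF S] by (simp add: pos_semidef_on_def cov)
    qed
    from edge_expectation_corr_le[OF G this pos(1,2,4,5,6)]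
    show "edge_expectation n G (ccorr (fst \<omega>) (snd \<omega>)) \<le> ?b + 4 / H / (real n)\<^sup>2 * ?gains \<omega>"
      by (simp add: \<omega> ccorr_def cgain_def)
  qed
  also have "\<dots> = ?b + 4 / H / (real n)\<^sup>2 * measure_pmf.expectation seed ?gains"
    by simp
  also have "\<dots> \<le> ?b + 4 / H / (real n)\<^sup>2 * ((real n)\<^sup>2 / real r)"
    using expectation_gain_seed[OF pos(1,3)] pos by (intro add_left_mono mult_left_mono) auto
  also have "\<dots> = ?b + 4 / (H * real r)" using pos by (simp add: field_simps)
  finally show ?thesis .
qed

end

section \<open>Choice of the constants\<close>

theorem theorem5p6:
  shows "\<exists>C c :: real. C > 0 \<and> c > 0 \<and>
    (\<forall>(n::nat) (k::nat) (r::nat) (G :: real mat) (\<epsilon>::real) (\<mu> :: nat set \<Rightarrow> (nat \<Rightarrow> nat) pmf).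
       regular_graph n G \<longrightarrow>
       \<epsilon> > 0 \<longrightarrow>
       local_rvs n k r \<mu> \<longrightarrow>
       (\<forall>S \<subseteq> {..<n}. card S \<le> r \<longrightarrow>
          (\<forall>y \<in> set_pmf (\<mu> S).
             pos_semidef_on ({..<n} \<times> {..<k}) (cond_cov_matrix \<mu> S y))) \<longrightarrow>
       real r \<ge> C * (real k / \<epsilon> ^ 4) * real (threshold_rank (c * (\<epsilon> / real k)\<^sup>2) G) \<longrightarrow>
       edge_expectation n G (\<lambda>i j.
         l1_dist_on ({..<k} \<times> {..<k})
           (pair_dist (\<mu> {i, j}) i j)
           (pair_dist (propagation_sampling n r \<mu>) i j)) \<le> \<epsilon>)"
proof (rule exI[of _ 128], rule exI[of _ "1 / 8"], intro conjI allI impI)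
  fix n k r :: nat and G :: "real mat" and \<epsilon> :: real and \<mu> :: "nat set \<Rightarrow> (nat \<Rightarrow> nat) pmf"
  assume G: "regular_graph n G" and eps: "\<epsilon> > 0" and loc: "local_rvs n k r \<mu>"
    and psd: "\<forall>S \<subseteq> {..<n}. card S \<le> r \<longrightarrow> (\<forall>y \<in> set_pmf (\<mu> S).
      pos_semidef_on ({..<n} \<times> {..<k}) (cond_cov_matrix \<mu> S y))"
    and r: "real r \<ge> 128 * (real k / \<epsilon> ^ 4) * real (threshold_rank (1 / 8 * (\<epsilon> / real k)\<^sup>2) G)"
  interpret local_random_variables n k r \<mu> using loc by unfold_locales
  let ?f = "\<lambda>i j. l1_dist_on ({..<k} \<times> {..<k}) (pair_dist (\<mu> {i, j}) i j)
      (pair_dist (propagation_sampling n r \<mu>) i j)"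
  \<comment> \<open>The factor \<open>c = 1 / 8\<close> makes the part of the spectrum up to
    \<open>\<tau>\<close> contribute at most \<open>\<epsilon> / 8\<close>.\<close>
  define \<tau> where "\<tau> = 1 / 8 * (\<epsilon> / real k)\<^sup>2"
  define R where "R = real (threshold_rank \<tau> G)"
  show "edge_expectation n G ?f \<le> \<epsilon>"
  \<comment> \<open>An l1 distance never exceeds \<open>2\<close>. The remaining bound
    \<open>\<epsilon> < 2\<close> gives \<open>\<tau> < 1\<close> and helps with the seed
    term.\<close>
  proof (cases "n = 0 \<or> \<epsilon> \<ge> 2")
    case True
    show ?thesis
    proof (cases "n = 0")
      case True
      thus ?thesis using eps by (simp add: edge_expectation_def)
    next
      case False
      have "edge_expectation n G ?f \<le> edge_expectation n G (\<lambda>_ _. 2)"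
        by (intro edge_expectation_mono[OF G] l1_dist_on_le_2) auto
      also have "\<dots> = 2" using edge_expectation_const[OF G] False by simp
      finally show ?thesis using True False by simp
    qed
  next
    case False
    hence n: "0 < n" and eps2: "\<epsilon> < 2" by auto
    \<comment> \<open>Over an empty alphabet \<open>\<mu> {0}\<close> would have empty
      support.\<close>
    have k: "0 < k"
    proof (rule ccontr)
      assume "\<not> 0 < k"
      hence "set_pmf (\<mu> {0}) = {}" using set_local[of "{0}"] n by (auto simp: PiE_eq_empty_iff)
      thus False by (simp add: set_pmf_not_empty)
    qed
    have "\<epsilon> / real k \<le> \<epsilon>" using k eps by (simp add: divide_le_eq)
    hence "\<tau> \<le> 1 / 8 * \<epsilon>\<^sup>2"
      using eps unfolding \<tau>_def by (intro mult_left_mono power_mono) auto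
    also have "\<dots> < 1 / 8 * 2\<^sup>2" using eps eps2 by (intro mult_strict_left_mono power_strict_mono) auto
    finally have "\<tau> < 1" by simp
    hence "R \<ge> 1" using threshold_rank_pos[OF G n] by (simp add: R_def Suc_leI)
    \<comment> \<open>Chosen so that the large eigenvalues contribute exactly
      \<open>\<epsilon> / 8\<close>; division by \<open>R\<close> is safe because
      \<open>\<tau> < 1\<close> makes the rank positive.\<close>
    define H where "H = \<epsilon>\<^sup>2 / (8 * real k * R)"
    have H: "H > 0" using eps k \<open>R \<ge> 1\<close> by (simp add: H_def)
    have r': "128 * real k * R \<le> real r * \<epsilon> ^ 4"
      using r eps by (simp add: R_def \<tau>_def divide_le_eq mult.commute mult.left_commute)
    \<comment> \<open>The lower bound on \<open>r\<close> is positive, which excludes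
      \<open>r = 0\<close>.\<close>
    have "0 < real r * \<epsilon> ^ 4" using r' k \<open>R \<ge> 1\<close> by (intro less_le_trans[OF _ r']) simp
    hence rpos: "0 < r" using eps by (simp add: zero_less_mult_iff)
    have top: "real k / \<epsilon> * \<tau> \<le> \<epsilon> / 8"
    proof -
      have "real k / \<epsilon> * \<tau> = \<epsilon> / 8 / real k" using k eps by (simp add: \<tau>_def field_simps power2_eq_square)
      also have "\<dots> \<le> \<epsilon> / 8" using k eps by (simp add: divide_le_eq)
      finally show ?thesis .
    qed
    have mid: "real k / \<epsilon> * (R * H) = \<epsilon> / 8"
      using k eps \<open>R \<ge> 1\<close> by (simp add: H_def field_simps power2_eq_square)
    have low: "4 / (H * real r) \<le> \<epsilon> / 2"
    proof -
      \<comment> \<open>The seed term needs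
        \<open>64 * real k * R \<le> real r * \<epsilon> ^ 3\<close>; \<open>C = 128\<close> gives
        this from the fourth power because \<open>\<epsilon> < 2\<close>.\<close>
      have "64 * real k * R * \<epsilon> \<le> 64 * real k * R * 2"
        using eps2 \<open>R \<ge> 1\<close> by (intro mult_left_mono) auto
      also have "\<dots> \<le> real r * \<epsilon> ^ 4" using r' by simp
      finally have "(64 * real k * R) * \<epsilon> \<le> (real r * \<epsilon> ^ 3) * \<epsilon>"
        by (simp add: power4_eq_xxxx power3_eq_cube mult.assoc)
      hence "64 * real k * R \<le> real r * \<epsilon> ^ 3" using eps by simp
      thus ?thesis
        using k eps \<open>R \<ge> 1\<close> rpos by (simp add: H_def field_simps power2_eq_square power3_eq_cube)
    qed
    have "edge_expectation n G ?f \<le> \<epsilon> / 4 + real k / \<epsilon> * (\<tau> + R * H) + 4 / (H * real r)"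
      unfolding R_def using psd n k rpos eps H
      by (intro edge_expectation_propagation_le[OF G]) (auto simp: \<tau>_def)
    also have "\<dots> = \<epsilon> / 4 + (real k / \<epsilon> * \<tau> + \<epsilon> / 8) + 4 / (H * real r)"
      unfolding distrib_left mid ..
    also have "\<dots> \<le> \<epsilon> / 4 + (\<epsilon> / 8 + \<epsilon> / 8) + \<epsilon> / 2"
      by (intro add_mono top low order_refl)
    also have "\<dots> = \<epsilon>" by simp
    finally show ?thesis .
  qed
qed simp_all

end
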